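(* Let $q_1$ be a power of $2$ (with $q_1\geq 2$), $q=q_1^2$, and let $m$ be even (and positive). Let $n=q^m-1$ and let $\beta$ be a primitive $n$-th root of unity in $\mathbb{F}_{q^m}$. Put $\delta=q_1^{m+1}-2q_1^2+1$ and assume $\delta\ge 2$. Let $g(x)$ be the generator polynomial of the BCH code $\mathcal{C}_{(q,n,\delta,1,\beta)}$ and $g^{\perp_H}(x)$ the generator polynomial of its Hermitian dual $\mathcal{C}_{(q,n,\delta,1,\beta)}^{\perp_H}$. Let $\mathcal{C}'$ denote the cyclic code of length $2n$ over $\mathbb{F}_q$ with generator polynomial $g(x)g^{\perp_H}(x)$. Then $\mathcal{C}'$ is a Hermitian self-dual cyclic code with parameters $[2n,n,d]_q$, where (i) if $m\ge 4$, then $d=\min\{2d(\mathcal{C}_{(q,n,\delta,1,\beta)}),\,d(\mathcal{C}_{(q,n,\delta,1,\beta)}^{\perp_H})\}\ge q_1^{m+1}+3$; (ii) if $q_1\ge 8$ and $m=2$, then $d=\min\{2d(\mathcal{C}_{(q,n,\delta,1,\beta)}),\,d(\mathcal{C}_{(q,n,\delta,1,\beta)}^{\perp_H})\}\ge q_1^3+2q_1+4$; (iii) if $q_1=4$ and $m=2$, then $d=\min\{2d(\mathcal{C}_{(q,n,\delta,1,\beta)}),\,d(\mathcal{C}_{(q,n,\delta,1,\beta)}^{\perp_H})\}\ge 66$.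
   Context: An $[n,k,d]_q$ code is a $k$-dimensional linear subspace of $\mathbb{F}_q^n$ with minimum Hamming distance $d$; $d(\mathcal{C})$ denotes the minimum Hamming distance of $\mathcal{C}$. For $q=q_1^2$, the Hermitian inner product on $\mathbb{F}_q^n$ is $\langle x,y\rangle_H=\sum_i x_iy_i^{q_1}$, the Hermitian dual is $\mathcal{C}^{\perp_H}=\{c\in\mathbb{F}_q^n:\langle c,y\rangle_H=0\ \forall y\in\mathcal{C}\}$, and $\mathcal{C}$ is Hermitian self-dual if $\mathcal{C}=\mathcal{C}^{\perp_H}$. A cyclic code of length $N$ over $\mathbb{F}_q$ is identified with an ideal of $\mathbb{F}_q[x]/\langle x^N-1\rangle$ via $(c_0,\dots,c_{N-1})\mapsto c_0+c_1x+\dots+c_{N-1}x^{N-1}$; its generator polynomial is the unique monic divisor of $x^N-1$ generating it. For $\gcd(n,q)=1$ and $\beta$ a primitive $n$-th root of unity, $m_{\beta^i}(x)$ denotes the minimal polynomial of $\beta^i$ over $\mathbb{F}_q$. For integers $\delta\ge2$ and $b$, the BCH code $\mathcal{C}_{(q,n,\delta,b,\beta)}$ is the cyclic code of length $n$ over $\mathbb{F}_q$ with generator polynomial $\mathrm{lcm}\{m_{\beta^b}(x),\dots,m_{\beta^{b+\delta-2}}(x)\}$. *)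

theory Defs
  imports
    "HOL-Library.Cardinality"
    "HOL-Computational_Algebra.Polynomial"
    "Jordan_Normal_Form.VS_Connect"
begin

text \<open>
  The base field \<open>\<F>\<^sub>q\<close> is a finite field type \<open>'a\<close>, the extension field
  a finite field type \<open>'b\<close>, and the inclusion a field homomorphism
  \<open>\<iota> :: 'a \<Rightarrow> 'b\<close>. Words of length \<open>N\<close> are elements of \<^term>\<open>carrier_vec N\<close>.
\<close>

definition linear_code :: "nat \<Rightarrow> 'a::field vec set \<Rightarrow> bool" where
  "linear_code N C \<longleftrightarrow> VectorSpace.subspace class_ring C (module_vec TYPE('a) N)"

definition code_dim :: "nat \<Rightarrow> 'a::field vec set \<Rightarrow> nat" where
  "code_dim N C = vectorspace.dim class_ring ((module_vec TYPE('a) N)\<lparr>carrier := C\<rparr>)"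

definition hamming_dist :: "'a vec \<Rightarrow> 'a vec \<Rightarrow> nat" where
  "hamming_dist x y = card {i. i < dim_vec x \<and> x $ i \<noteq> y $ i}"

text \<open>Only meaningful for codes with at least two words.\<close>

definition min_distance :: "'a vec set \<Rightarrow> nat" where
  "min_distance C = (LEAST d. \<exists>x\<in>C. \<exists>y\<in>C. x \<noteq> y \<and> d = hamming_dist x y)"

definition code_params :: "nat \<Rightarrow> nat \<Rightarrow> nat \<Rightarrow> 'a::field vec set \<Rightarrow> bool" where
  "code_params N k d C \<longleftrightarrow> linear_code N C \<and> code_dim N C = k \<and> min_distance C = d"

definition hermitian_prod :: "nat \<Rightarrow> 'a::field vec \<Rightarrow> 'a vec \<Rightarrow> 'a" where
  "hermitian_prod q1 x y = (\<Sum>i<dim_vec x. x $ i * (y $ i) ^ q1)"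

definition hermitian_dual :: "nat \<Rightarrow> nat \<Rightarrow> 'a::field vec set \<Rightarrow> 'a vec set" where
  "hermitian_dual q1 N C = {c \<in> carrier_vec N. \<forall>y\<in>C. hermitian_prod q1 c y = 0}"

definition hermitian_self_dual :: "nat \<Rightarrow> nat \<Rightarrow> 'a::field vec set \<Rightarrow> bool" where
  "hermitian_self_dual q1 N C \<longleftrightarrow> C = hermitian_dual q1 N C"

definition cyclic_shift :: "nat \<Rightarrow> 'a vec \<Rightarrow> 'a vec" where
  "cyclic_shift N c = vec N (\<lambda>i. c $ ((i + N - 1) mod N))"

definition cyclic_code :: "nat \<Rightarrow> 'a::field vec set \<Rightarrow> bool" where
  "cyclic_code N C \<longleftrightarrow> linear_code N C \<and> (\<forall>c\<in>C. cyclic_shift N c \<in> C)"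

definition word_poly :: "'a::field vec \<Rightarrow> 'a poly" where
  "word_poly c = (\<Sum>i<dim_vec c. monom (c $ i) i)"

text \<open>
  Elements of \<open>\<F>\<^sub>q[x]/\<langle>x\<^sup>N - 1\<rangle>\<close> are represented by their remainders modulo \<open>x\<^sup>N - 1\<close>;
  this is the set of words corresponding to the ideal generated by the class of \<open>g\<close>.
\<close>

definition code_generated_by :: "nat \<Rightarrow> 'a::field poly \<Rightarrow> 'a vec set" where
  "code_generated_by N g =
     {c \<in> carrier_vec N. \<exists>h. word_poly c = (h * g) mod (monom 1 N - 1)}"

definition is_generator_poly :: "nat \<Rightarrow> 'a::field vec set \<Rightarrow> 'a poly \<Rightarrow> bool" where
  "is_generator_poly N C g \<longleftrightarrow>
     lead_coeff g = 1 \<and> g dvd monom 1 N - 1 \<and> C = code_generated_by N g"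

definition generator_poly :: "nat \<Rightarrow> 'a::field vec set \<Rightarrow> 'a poly" where
  "generator_poly N C = (THE g. is_generator_poly N C g)"

definition primitive_root_of_unity :: "nat \<Rightarrow> 'b::field \<Rightarrow> bool" where
  "primitive_root_of_unity n x \<longleftrightarrow> n > 0 \<and> x ^ n = 1 \<and> (\<forall>k. 0 < k \<and> k < n \<longrightarrow> x ^ k \<noteq> 1)"

definition minimal_poly :: "('a::field \<Rightarrow> 'b::field) \<Rightarrow> 'b \<Rightarrow> 'a poly" where
  "minimal_poly \<iota> x =
     (THE p. lead_coeff p = 1 \<and> poly (map_poly \<iota> p) x = 0 \<and>
        (\<forall>h. h \<noteq> 0 \<and> poly (map_poly \<iota> h) x = 0 \<longrightarrow> degree p \<le> degree h))"

text \<open>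
  The library's \<^const>\<open>Lcm\<close> on polynomials needs a coefficient type of class
  \<^class>\<open>field_gcd\<close>; the following works over every field type.
\<close>

definition monic_Lcm :: "'a::field poly set \<Rightarrow> 'a poly" where
  "monic_Lcm P =
     (THE l. lead_coeff l = 1 \<and> (\<forall>p\<in>P. p dvd l) \<and> (\<forall>h. (\<forall>p\<in>P. p dvd h) \<longrightarrow> l dvd h))"

definition bch_code ::
  "('a::field \<Rightarrow> 'b::field) \<Rightarrow> nat \<Rightarrow> nat \<Rightarrow> int \<Rightarrow> 'b \<Rightarrow> 'a vec set" where
  "bch_code \<iota> n \<delta> b \<beta> =
     code_generated_by n (monic_Lcm ((\<lambda>i. minimal_poly \<iota> (\<beta> powi i)) ` {b..b + int \<delta> - 2}))"

end

theory Submission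
  imports Defs "Jordan_Normal_Form.Char_Poly"
begin

text \<open>
  Write \<open>b = q1\<close>. If \<open>g * h = x\<^sup>N - 1\<close>, the Hermitian dual of the cyclic code generated by \<open>g\<close> is
  generated by the reciprocal of \<open>h\<close> with conjugated coefficients. Applied to \<open>N = n\<close> and to
  \<open>N = 2 n\<close>, where \<open>x\<^sup>2\<^sup>n - 1 = (x\<^sup>n - 1)\<^sup>2\<close>, this gives the self-duality. Reducing a word of length
  \<open>2 n\<close> modulo \<open>x\<^sup>n - 1\<close> gives the formula for the minimum distance.

  The dual of the BCH code has the zeros \<open>\<beta>\<^sup>j\<close> with \<open>0 \<le> j \<le> J\<close> and with \<open>P \<le> j \<le> P + J\<close>, where
  \<open>P = b ^ (m + 1)\<close>, and \<open>J = P - b\<^sup>2\<close> or, for \<open>m = 2\<close>, even \<open>J = b\<^sup>3 - b\<^sup>2 + 2 b - 1\<close>. By linear algebra, the support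
  of a word of small weight \<open>w\<close> then satisfies an equation \<open>u(x) + x\<^sup>P v(x) = 0\<close> with \<open>u, v\<close> of degree at most
  \<open>w - J - 2\<close>. Since \<open>x ^ (P * Q) = x\<close> for \<open>Q = b ^ (m - 1)\<close>, its \<open>Q\<close>-th power is a polynomial
  equation of degree at most \<open>Q (w - J - 2) + 1\<close>, which bounds \<open>w\<close> from below.
\<close>

subsection \<open>Words and polynomials\<close>

lemma coeff_word_poly: "coeff (word_poly c) i = (if i < dim_vec c then c $ i else 0)"
  by (auto simp: word_poly_def coeff_sum if_distrib[of "\<lambda>x. x * _"] cong: if_cong)

lemma degree_word_poly:
  assumes "dim_vec c = N" "N > 0"
  shows "degree (word_poly c) < N"
  using assms by (intro degree_lessI) (auto simp: coeff_word_poly)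

lemma word_poly_vec_coeff: "degree p < N \<Longrightarrow> word_poly (vec N (coeff p)) = p"
  by (rule poly_eqI) (auto simp: coeff_word_poly coeff_eq_0)

lemma word_poly_eq_iff:
  "c \<in> carrier_vec N \<Longrightarrow> d \<in> carrier_vec N \<Longrightarrow> word_poly c = word_poly d \<longleftrightarrow> c = d"
  by (auto simp: poly_eq_iff coeff_word_poly intro!: eq_vecI split: if_splits)

lemma word_poly_zero [simp]: "word_poly (0\<^sub>v N) = 0"
  by (rule poly_eqI) (simp add: coeff_word_poly)

lemma word_poly_add:
  "c \<in> carrier_vec N \<Longrightarrow> d \<in> carrier_vec N \<Longrightarrow> word_poly (c + d) = word_poly c + word_poly d"
  by (rule poly_eqI) (auto simp: coeff_word_poly)

lemma word_poly_smult: "word_poly (a \<cdot>\<^sub>v c) = Polynomial.smult a (word_poly c)"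
  by (rule poly_eqI) (auto simp: coeff_word_poly)

lemma degree_monom_diff_1:
  assumes "N > 0"
  shows "degree (monom 1 N - 1 :: 'a::field poly) = N"
    and "monom 1 N - 1 \<noteq> (0 :: 'a poly)"
proof -
  have "coeff (monom 1 N - 1 :: 'a poly) N = 1"
    using assms by simp
  moreover have "degree (monom 1 N - 1 :: 'a poly) \<le> N"
    by (intro degree_diff_le degree_monom_le) auto
  ultimately show "degree (monom 1 N - 1 :: 'a poly) = N"
    by (metis le_antisym le_degree one_neq_zero)
  with assms show "monom 1 N - 1 \<noteq> (0 :: 'a poly)"
    by auto
qed

text \<open>Since \<open>g\<close> divides x^N - 1, reduction modulo x^N - 1 preserves divisibility
  by \<open>g\<close>; conversely a word polynomial has degree below \<open>N\<close> and is its own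
  remainder.\<close>

lemma code_generated_by_dvd:
  fixes g :: "'a::field poly"
  assumes "N > 0" "g dvd monom 1 N - 1"
  shows "code_generated_by N g = {c \<in> carrier_vec N. g dvd word_poly c}"
proof -
  have "g dvd word_poly c" if "word_poly c = (h * g) mod (monom 1 N - 1)" for c h
    using that assms by (simp add: dvd_mod)
  moreover have "\<exists>h. word_poly c = (h * g) mod (monom 1 N - 1)"
    if "c \<in> carrier_vec N" "g dvd word_poly c" for c
  proof -
    from that obtain h where "word_poly c = h * g"
      by (metis dvdE mult.commute)
    moreover have "degree (word_poly c) < N"
      using that assms by (intro degree_word_poly) auto
    ultimately show ?thesis
      using degree_monom_diff_1[OF assms(1), where 'a='a] by (metis mod_poly_less)
  qed
  ultimately show ?thesis
    unfolding code_generated_by_def by blast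
qed

text \<open>A generator of degree below \<open>N\<close> is itself a word of the code, so the other
  generator divides it. By symmetry the two monic polynomials divide each other.\<close>

lemma is_generator_poly_unique:
  fixes g g' :: "'a::field poly"
  assumes "N > 0" "is_generator_poly N C g" "is_generator_poly N C g'"
  shows "g = g'"
proof -
  let ?M = "monom 1 N - 1 :: 'a poly"
  have "g dvd g'" if "is_generator_poly N C g" "is_generator_poly N C g'" for g g'
  proof (cases "degree g' < N")
    case True
    from that have dvds: "g dvd ?M" "g' dvd ?M"
      and eq: "code_generated_by N g = code_generated_by N g'"
      by (auto simp: is_generator_poly_def)
    have "vec N (coeff g') \<in> code_generated_by N g"
      unfolding eq using True assms(1) by (simp add: code_generated_by_dvd dvds word_poly_vec_coeff)
    then show ?thesis
      using True assms(1) by (simp add: code_generated_by_dvd dvds word_poly_vec_coeff)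
  next
    \<comment> \<open>Degree \<open>N\<close> belongs to the zero code: \<open>g'\<close> is then an
      associate of x^N - 1, hence a multiple of \<open>g\<close>.\<close>
    case False
    from that have gM: "g dvd ?M" "g' dvd ?M"
      by (auto simp: is_generator_poly_def)
    then obtain k where k: "?M = g' * k"
      by (elim dvdE)
    from k degree_monom_diff_1[OF assms(1), where 'a='a] have "g' \<noteq> 0" "k \<noteq> 0"
      and "degree g' + degree k = N"
      by (auto simp: degree_mult_eq)
    with False have "is_unit k"
      by (simp add: is_unit_iff_degree)
    with gM k show ?thesis
      by (simp add: dvd_mult_unit_iff)
  qed
  then have "g dvd g'" "g' dvd g"
    using assms by blast+
  moreover have "lead_coeff g = 1" "lead_coeff g' = 1"
    using assms by (auto simp: is_generator_poly_def)
  ultimately show ?thesis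
    by (metis poly_dvd_antisym)
qed

lemma generator_poly_eqI:
  assumes "N > 0" "is_generator_poly N C g"
  shows "generator_poly N C = g"
  unfolding generator_poly_def using assms is_generator_poly_unique by blast

lemma cyclic_shift_carrier: "cyclic_shift N c \<in> carrier_vec N"
  by (simp add: cyclic_shift_def)

lemma word_poly_cyclic_shift:
  assumes "c \<in> carrier_vec N" "N > 0"
  shows "word_poly (cyclic_shift N c) =
    monom 1 1 * word_poly c - Polynomial.smult (c $ (N - 1)) (monom 1 N - 1)"
proof (rule poly_eqI)
  fix i
  show "coeff (word_poly (cyclic_shift N c)) i =
    coeff (monom 1 1 * word_poly c - Polynomial.smult (c $ (N - 1)) (monom 1 N - 1)) i"
  proof (cases i)
    case 0
    with assms show ?thesis
      by (simp add: coeff_word_poly cyclic_shift_def coeff_monom_mult)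
  next
    case (Suc k)
    then show ?thesis
    proof (cases "Suc k < N")
      case True
      then have "(Suc k + N - 1) mod N = k"
        by simp
      with True Suc assms show ?thesis
        by (simp add: coeff_word_poly cyclic_shift_def coeff_monom_mult)
    next
      case False
      then have "k < N \<Longrightarrow> k = N - 1"
        by simp
      with False Suc assms show ?thesis
        by (auto simp: coeff_word_poly cyclic_shift_def coeff_monom_mult)
    qed
  qed
qed

lemma linear_code_dvd: "linear_code N {c \<in> carrier_vec N. (g :: 'a::field poly) dvd word_poly c}"
  unfolding linear_code_def VectorSpace.subspace_def LinearCombinations.submodule_def
  using vec_vs vec_module
  by (auto simp: module_vec_simps word_poly_add word_poly_smult dvd_smult)

lemma cyclic_code_dvd:
  assumes "N > 0" "(g :: 'a::field poly) dvd monom 1 N - 1"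
  shows "cyclic_code N {c \<in> carrier_vec N. g dvd word_poly c}"
  unfolding cyclic_code_def
  using assms linear_code_dvd[of N g]
  by (auto simp: word_poly_cyclic_shift cyclic_shift_carrier intro!: dvd_diff dvd_smult)

subsection \<open>Finite fields of characteristic 2\<close>

text \<open>Multiplication by a nonzero \<open>x\<close> permutes the nonzero elements; comparing
  their products before and after gives the claim.\<close>

lemma finite_field_power_CARD:
  fixes x :: "'a::{field,finite}"
  shows "x ^ CARD('a) = x"
proof (cases "x = 0")
  case False
  let ?U = "UNIV - {0 :: 'a}"
  have "bij_betw ((*) x) ?U ?U"
    using False by (intro bij_betw_byWitness[where f' = "\<lambda>y. y / x"]) auto
  then have "(\<Prod>y\<in>?U. y) = (\<Prod>y\<in>?U. x * y)"
    by (rule prod.reindex_bij_betw[symmetric])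
  also have "\<dots> = x ^ (CARD('a) - 1) * (\<Prod>y\<in>?U. y)"
    by (simp add: prod.distrib card_Diff_subset)
  finally have "x ^ (CARD('a) - 1) = 1"
    by simp
  then show ?thesis
    by (metis One_nat_def Suc_pred finite_UNIV_card_ge_0 finite mult.right_neutral power_Suc)
qed simp

lemma finite_field_two_eq_0:
  assumes "even CARD('a::{field,finite})"
  shows "(2 :: 'a) = 0"
proof -
  have "(- 1 :: 'a) = (- 1) ^ CARD('a)"
    by (simp add: finite_field_power_CARD)
  also have "\<dots> = 1"
    using assms by simp
  finally show ?thesis
    by (metis add.right_inverse one_add_one)
qed

lemma power_2_power_add:
  fixes x y :: "'a::comm_ring_1"
  assumes "(2 :: 'a) = 0"
  shows "(x + y) ^ (2 ^ k) = x ^ (2 ^ k) + y ^ (2 ^ k)"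
proof (induction k)
  case (Suc k)
  have "(x + y) ^ 2 ^ Suc k = ((x + y) ^ 2 ^ k) ^ 2"
    by (simp add: mult.commute flip: power_mult)
  also have "\<dots> = (x ^ 2 ^ k) ^ 2 + (y ^ 2 ^ k) ^ 2"
    unfolding Suc.IH power2_sum using assms by simp
  also have "\<dots> = x ^ 2 ^ Suc k + y ^ 2 ^ Suc k"
    by (simp add: mult.commute flip: power_mult)
  finally show ?case .
qed simp

lemma field_hom_power_2_power:
  assumes "(2 :: 'a::field) = 0"
  shows "field_hom (\<lambda>a::'a. a ^ (2 ^ k))"
  by unfold_locales (simp_all add: power_2_power_add[OF assms] power_mult_distrib)

lemma poly_map_poly_power_2_power:
  assumes "(2 :: 'b::field) = 0" "field_hom (\<iota> :: 'a::field \<Rightarrow> 'b)"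
  shows "poly (map_poly \<iota> (map_poly (\<lambda>a. a ^ (2 ^ k)) p)) (z ^ (2 ^ k)) = poly (map_poly \<iota> p) z ^ (2 ^ k)"
proof -
  interpret \<iota>: field_hom \<iota> by fact
  interpret frob: field_hom "\<lambda>a::'b. a ^ (2 ^ k)"
    using assms(1) by (rule field_hom_power_2_power)
  have "map_poly \<iota> (map_poly (\<lambda>a. a ^ (2 ^ k)) p) = map_poly (\<lambda>a. a ^ (2 ^ k)) (map_poly \<iota> p)"
    by (rule poly_eqI) (simp add: coeff_map_poly \<iota>.hom_power)
  then show ?thesis
    by (simp only: frob.poly_map_poly)
qed

text \<open>The fixed points are the roots of a polynomial of degree \<open>CARD('a)\<close>, and
  the injective image of \<iota> already supplies that many.\<close>

lemma field_hom_range_eq_fixed_points: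
  fixes \<iota> :: "'a::{field,finite} \<Rightarrow> 'b::field"
  assumes "field_hom \<iota>"
  shows "range \<iota> = {y. y ^ CARD('a) = y}"
proof -
  interpret \<iota>: field_hom \<iota> by fact
  let ?p = "monom 1 CARD('a) - monom 1 1 :: 'b poly"
  have "card {0, 1 :: 'a} \<le> CARD('a)"
    by (intro card_mono) auto
  then have gt: "CARD('a) > 1"
    by simp
  have coeff: "coeff ?p CARD('a) = 1"
    using gt by simp
  then have nz: "?p \<noteq> 0"
    by (metis coeff_0 zero_neq_one)
  have eq: "{y. poly ?p y = 0} = {y. y ^ CARD('a) = y}"
    by (auto simp: poly_monom)
  have fin: "finite {y::'b. y ^ CARD('a) = y}"
    using poly_roots_finite[OF nz] unfolding eq .
  show ?thesis
  proof (rule card_subset_eq[OF fin])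
    show "range \<iota> \<subseteq> {y. y ^ CARD('a) = y}"
      by (auto simp: finite_field_power_CARD simp flip: \<iota>.hom_power)
    have "card {y. poly ?p y = 0} \<le> degree ?p"
      using nz by (rule card_poly_roots_bound)
    also have "\<dots> \<le> CARD('a)"
      using gt by (intro degree_diff_le order_trans[OF degree_monom_le]) auto
    also have "\<dots> = card (range \<iota>)"
      using \<iota>.inj_f by (simp add: card_image)
    finally have "card {y::'b. y ^ CARD('a) = y} \<le> card (range \<iota>)"
      unfolding eq .
    moreover have "card (range \<iota>) \<le> card {y::'b. y ^ CARD('a) = y}"
      using \<open>range \<iota> \<subseteq> _\<close> fin by (rule card_mono[rotated])
    ultimately show "card (range \<iota>) = card {y::'b. y ^ CARD('a) = y}"
      by simp
  qed
qed

text \<open>Raising to the power \<open>CARD('a)\<close> permutes the factors cyclically, so it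
  fixes the coefficients of the product, which therefore come from the base field. The lemma serves
  to locate the roots of the generator polynomial in Frobenius orbits.\<close>

lemma conjugates_poly:
  fixes \<iota> :: "'a::{field,finite} \<Rightarrow> 'b::{field,finite}"
  assumes \<iota>: "field_hom \<iota>" and two: "(2 :: 'b) = 0"
    and q: "CARD('a) = 2 ^ l" and card: "CARD('b) = CARD('a) ^ m"
  obtains p where "map_poly \<iota> p = (\<Prod>k<m. [:- (x ^ (CARD('a) ^ k)), 1:])"
proof -
  let ?P = "\<Prod>k<m. [:- (x ^ (CARD('a) ^ k)), 1:]"
  interpret \<iota>: field_hom \<iota> by fact
  have "field_hom (\<lambda>a::'b. a ^ CARD('a))"
    unfolding q using two by (rule field_hom_power_2_power)
  then interpret frob: field_hom "\<lambda>a::'b. a ^ CARD('a)" .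
  interpret mfrob: map_poly_inj_idom_hom "\<lambda>a::'b. a ^ CARD('a)" ..
  have "m > 0"
  proof (rule ccontr)
    assume "\<not> m > 0"
    then have "CARD('b) = 1"
      using card by simp
    moreover have "card {0, 1 :: 'b} \<le> CARD('b)"
      by (intro card_mono) auto
    ultimately show False
      by simp
  qed
  have "map_poly (\<lambda>a. a ^ CARD('a)) ?P = (\<Prod>k<m. [:- (x ^ (CARD('a) ^ Suc k)), 1:])"
    unfolding mfrob.hom_prod
    by (intro prod.cong refl)
      (simp add: frob.map_poly_pCons_hom frob.hom_uminus power_mult[symmetric] mult.commute)
  also have "\<dots> = (\<Prod>k\<in>{1..<Suc m}. [:- (x ^ (CARD('a) ^ k)), 1:])"
    by (rule prod.reindex_bij_witness[of _ "\<lambda>k. k - 1" Suc]) auto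
  also have "{1..<Suc m} = insert m {1..<m}"
    using \<open>m > 0\<close> by auto
  \<comment> \<open>The cycle closes: the exponent \<open>CARD('a) ^ m\<close> is the size of the
    extension field, so factor \<open>m\<close> equals factor 0.\<close>
  also have "(\<Prod>k\<in>insert m {1..<m}. [:- (x ^ (CARD('a) ^ k)), 1:]) =
      (\<Prod>k\<in>insert 0 {1..<m}. [:- (x ^ (CARD('a) ^ k)), 1:])"
    using finite_field_power_CARD[of x] by (simp add: card)
  also have "insert 0 {1..<m} = {..<m}"
    using \<open>m > 0\<close> by auto
  finally have fixed: "map_poly (\<lambda>a. a ^ CARD('a)) ?P = ?P" .
  have "coeff ?P i \<in> range \<iota>" for i
  proof -
    have "coeff ?P i ^ CARD('a) = coeff ?P i"
      by (metis fixed frob.coeff_map_poly_hom)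
    then show ?thesis
      unfolding field_hom_range_eq_fixed_points[OF \<iota>] by simp
  qed
  then have "\<iota> (inv_into UNIV \<iota> (coeff ?P i)) = coeff ?P i" for i
    by (rule f_inv_into_f)
  moreover have "inv_into UNIV \<iota> 0 = 0"
    by (metis \<iota>.hom_zero \<iota>.inj_f inv_f_f)
  ultimately have "map_poly \<iota> (map_poly (inv_into UNIV \<iota>) ?P) = ?P"
    by (intro poly_eqI) (simp add: coeff_map_poly)
  then show thesis
    by (rule that)
qed

subsection \<open>Lower bounds for the weight of a word with consecutive zeros\<close>

lemma sum_mult_poly_eq_0:
  fixes c x :: "'i \<Rightarrow> 'b::comm_ring_1"
  assumes "\<And>j. j \<le> k \<Longrightarrow> (\<Sum>t\<in>T. c t * x t ^ j) = 0" and "degree p \<le> k"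
  shows "(\<Sum>t\<in>T. c t * poly p (x t)) = 0"
proof -
  have "(\<Sum>t\<in>T. c t * poly p (x t)) = (\<Sum>t\<in>T. \<Sum>j\<le>degree p. coeff p j * (c t * x t ^ j))"
    by (simp add: poly_altdef sum_distrib_left mult_ac)
  also have "\<dots> = (\<Sum>j\<le>degree p. coeff p j * (\<Sum>t\<in>T. c t * x t ^ j))"
    by (subst sum.swap) (simp add: sum_distrib_left)
  also have "\<dots> = 0"
    using assms by (intro sum.neutral) auto
  finally show ?thesis .
qed

text \<open>Up to a scalar this is a Lagrange basis polynomial; summing against it isolates a single
  point of the support.\<close>

lemma vanishing_poly:
  fixes x :: "'i \<Rightarrow> 'b::field"
  assumes "finite T" "inj_on x T" "t \<in> T"
  obtains p where "degree p = card T - 1" "poly p (x t) \<noteq> 0"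
    "\<And>s. s \<in> T \<Longrightarrow> s \<noteq> t \<Longrightarrow> poly p (x s) = 0"
proof
  let ?p = "\<Prod>s\<in>T - {t}. [:- x s, 1:]"
  show "degree ?p = card T - 1"
    using assms by (subst degree_prod_eq_sum_degree) auto
  show "poly ?p (x t) \<noteq> 0"
    using assms by (auto simp: poly_prod inj_on_def)
  show "poly ?p (x s) = 0" if "s \<in> T" "s \<noteq> t" for s
    using that assms by (auto simp: poly_prod)
qed

text \<open>The BCH bound. On a support of at most \<open>k + 1\<close> points, a polynomial of
  degree at most \<open>k\<close> vanishes at all points but one, and the sum against it would be a
  single nonzero term.\<close>

lemma weight_gt_run:
  fixes c x :: "'i \<Rightarrow> 'b::field"
  assumes "finite T" "T \<noteq> {}" "inj_on x T"
    and nz: "\<And>t. t \<in> T \<Longrightarrow> c t \<noteq> 0"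
    and run: "\<And>j. j \<le> k \<Longrightarrow> (\<Sum>t\<in>T. c t * x t ^ j) = 0"
  shows "k + 2 \<le> card T"
proof (rule ccontr)
  assume "\<not> ?thesis"
  then have card: "card T - 1 \<le> k"
    by simp
  from \<open>T \<noteq> {}\<close> obtain t where t: "t \<in> T"
    by auto
  obtain p where p: "degree p = card T - 1" "poly p (x t) \<noteq> 0"
    and p0: "\<And>s. s \<in> T \<Longrightarrow> s \<noteq> t \<Longrightarrow> poly p (x s) = 0"
    using vanishing_poly[OF assms(1,3) t] by blast
  have "0 = (\<Sum>s\<in>T. c s * poly p (x s))"
    using run p(1) card by (subst sum_mult_poly_eq_0[of k]) auto
  also have "\<dots> = (\<Sum>s\<in>{t}. c s * poly p (x s))"
    using t p0 assms(1) by (intro sum.mono_neutral_right) auto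
  finally show False
    using p(2) nz[OF t] by simp
qed

text \<open>Bounding the degree through vanishing coefficients keeps the zero polynomial in the set
  also for \<open>k = 0\<close>, so one formula covers every \<open>k\<close>.\<close>

lemma card_poly_degree_less:
  "card {p :: 'a::{comm_ring_1,finite} poly. \<forall>i\<ge>k. coeff p i = 0} = CARD('a) ^ k"
proof -
  let ?S = "{p :: 'a poly. \<forall>i\<ge>k. coeff p i = 0}" and ?F = "{..<k} \<rightarrow>\<^sub>E (UNIV :: 'a set)"
  have "bij_betw (\<lambda>p. restrict (coeff p) {..<k}) ?S ?F"
  proof (rule bij_betw_byWitness[where f' = "\<lambda>f. Abs_poly (\<lambda>i. if i < k then f i else 0)"])
    have coeff: "coeff (Abs_poly (\<lambda>i. if i < k then f i else 0)) = (\<lambda>i. if i < k then f i else 0)"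
      for f :: "nat \<Rightarrow> 'a"
      by (rule coeff_Abs_poly[of k]) auto
    show "\<forall>p\<in>?S. Abs_poly (\<lambda>i. if i < k then restrict (coeff p) {..<k} i else 0) = p"
      by (auto intro!: poly_eqI simp: coeff)
    show "\<forall>f\<in>?F. restrict (coeff (Abs_poly (\<lambda>i. if i < k then f i else 0))) {..<k} = f"
      by (auto simp: coeff fun_eq_iff restrict_def PiE_def extensional_def)
    show "(\<lambda>p. restrict (coeff p) {..<k}) ` ?S \<subseteq> ?F"
      by (auto simp: PiE_def)
    show "(\<lambda>f. Abs_poly (\<lambda>i. if i < k then f i else 0)) ` ?F \<subseteq> ?S"
      by (rule image_subsetI) (simp add: coeff)
  qed
  then show ?thesis
    by (simp add: bij_betw_same_card card_PiE)
qed

text \<open>There are \<open>2 * Suc K\<close> free coefficients and fewer linear conditions. Over a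
  finite field pigeonhole suffices: two pairs with the same values on \<open>T\<close> have a
  nonzero difference that vanishes there.\<close>

lemma interpolating_pair:
  fixes x y :: "'i \<Rightarrow> 'b::{field,finite}"
  assumes "finite T" "card T < 2 * Suc K"
  obtains a b where "a \<noteq> 0 \<or> b \<noteq> 0" "degree a \<le> K" "degree b \<le> K"
    "\<And>t. t \<in> T \<Longrightarrow> poly a (x t) + y t * poly b (x t) = 0"
proof -
  let ?S = "{p :: 'b poly. \<forall>i\<ge>Suc K. coeff p i = 0}"
  let ?ev = "\<lambda>(a, b). restrict (\<lambda>t. poly a (x t) + y t * poly b (x t)) T"
  let ?F = "T \<rightarrow>\<^sub>E (UNIV :: 'b set)"
  have card_gt_1: "CARD('b) > 1"
  proof -
    have "card {0, 1 :: 'b} \<le> CARD('b)"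
      by (intro card_mono) auto
    then show ?thesis by simp
  qed
  have "card (?ev ` (?S \<times> ?S)) \<le> card ?F"
    using assms(1) by (intro card_mono finite_PiE) auto
  also have "\<dots> = CARD('b) ^ card T"
    using assms(1) by (simp add: card_PiE)
  also have "\<dots> < CARD('b) ^ (2 * Suc K)"
    using assms(2) card_gt_1 by (intro power_strict_increasing) auto
  also have "\<dots> = card (?S \<times> ?S)"
    by (simp only: card_poly_degree_less card_cartesian_product power_add mult_2)
  finally have "\<not> inj_on ?ev (?S \<times> ?S)"
    by (rule pigeonhole)
  then obtain a b a' b' where S: "a \<in> ?S" "b \<in> ?S" "a' \<in> ?S" "b' \<in> ?S"
    and ne: "(a, b) \<noteq> (a', b')" and eq: "?ev (a, b) = ?ev (a', b')"
    unfolding inj_on_def by blast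
  show thesis
  proof
    show "a - a' \<noteq> 0 \<or> b - b' \<noteq> 0"
      using ne by auto
    show "degree (a - a') \<le> K" "degree (b - b') \<le> K"
      using S by (auto intro!: degree_le simp: Suc_le_eq)
    fix t
    assume "t \<in> T"
    with fun_cong[OF eq, of t] show "poly (a - a') (x t) + y t * poly (b - b') (x t) = 0"
      by (simp add: algebra_simps)
  qed
qed

text \<open>
  The two runs force \<open>a x + x ^ P * b x = 0\<close> on the support for some \<open>(a, b) \<noteq> 0\<close> of degree at
  most \<open>card T - J - 2\<close>; taking \<open>Q\<close>-th powers and using \<open>x ^ (P * Q) = x\<close> turns this into
  a polynomial equation of low degree.
\<close>

lemma weight_two_runs:
  fixes c x :: "'i \<Rightarrow> 'b::{field,finite}"
  assumes T: "finite T" "T \<noteq> {}" "inj_on x T"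
    and nz: "\<And>t. t \<in> T \<Longrightarrow> c t \<noteq> 0"
    and run1: "\<And>j. j \<le> J \<Longrightarrow> (\<Sum>t\<in>T. c t * x t ^ j) = 0"
    and run2: "\<And>j. j \<le> J \<Longrightarrow> (\<Sum>t\<in>T. c t * x t ^ (P + j)) = 0"
    and PQ: "\<And>t. t \<in> T \<Longrightarrow> x t ^ (P * Q) = x t" and "Q \<ge> 2"
    and le: "card T \<le> 2 * J + 2"
  shows "card T \<le> Q * (card T - J - 2) + 1"
proof -
  \<comment> \<open>\<open>K\<close> is the excess of the weight over the BCH bound for one
    run.\<close>
  define K where "K = card T - J - 2"
  have ge: "J + 2 \<le> card T"
    using weight_gt_run[OF T nz run1] by simp
  then have "J - K + 1 \<le> card T" and KJ: "K \<le> J"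
    using le by (auto simp: K_def)
  \<comment> \<open>This size leaves \<open>2 * K + 1\<close> points outside \<open>T0\<close>, one
    fewer than the coefficients of \<open>a\<close> and \<open>b\<close>. Isolating a point inside
    \<open>T0\<close> costs degree \<open>J - K\<close>, which together with the degree
    \<open>K\<close> of \<open>a\<close> and \<open>b\<close> stays within \<open>J\<close>.\<close>
  then obtain T0 where T0: "T0 \<subseteq> T" "card T0 = J - K + 1"
    by (metis obtain_subset_with_card_n)
  have fin: "finite T0" "finite (T - T0)"
    using T T0 by (auto intro: finite_subset)
  have "card (T - T0) < 2 * Suc K"
    using T0 T(1) ge KJ fin by (simp add: card_Diff_subset K_def)
  then obtain a b where ab: "a \<noteq> 0 \<or> b \<noteq> 0" and deg: "degree a \<le> K" "degree b \<le> K"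
    and zero: "\<And>t. t \<in> T - T0 \<Longrightarrow> poly a (x t) + x t ^ P * poly b (x t) = 0"
    using interpolating_pair[OF fin(2), of K x "\<lambda>t. x t ^ P"] by blast
  have on_T: "poly a (x t) + x t ^ P * poly b (x t) = 0" if t: "t \<in> T" for t
  proof (cases "t \<in> T0")
    case True
    have "inj_on x T0"
      using T(3) T0(1) by (rule inj_on_subset)
    from vanishing_poly[OF fin(1) this True] obtain p where
      p: "degree p = card T0 - 1" "poly p (x t) \<noteq> 0"
      and p0: "\<And>s. s \<in> T0 \<Longrightarrow> s \<noteq> t \<Longrightarrow> poly p (x s) = 0"
      by blast
    have deg': "degree (a * p) \<le> J" "degree (b * p) \<le> J"
      using deg p(1) T0(2) KJ degree_mult_le[of a p] degree_mult_le[of b p] by linarith+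
    \<comment> \<open>Outside \<open>T0\<close> the first factor vanishes by interpolation, and
      inside \<open>T0\<close> the factor \<open>p\<close> vanishes except at \<open>t\<close>. The
      two runs make the whole sum 0, so the term at \<open>t\<close> is 0.\<close>
    have "(\<Sum>s\<in>T. c s * ((poly a (x s) + x s ^ P * poly b (x s)) * poly p (x s)))
      = (\<Sum>s\<in>T. c s * poly (a * p) (x s)) + (\<Sum>s\<in>T. (c s * x s ^ P) * poly (b * p) (x s))"
      by (simp add: sum.distrib algebra_simps)
    also have "(\<Sum>s\<in>T. c s * poly (a * p) (x s)) = 0"
      using run1 deg' by (intro sum_mult_poly_eq_0[of J])
    also have "(\<Sum>s\<in>T. (c s * x s ^ P) * poly (b * p) (x s)) = 0"
      using run2 deg' by (intro sum_mult_poly_eq_0[of J]) (auto simp: power_add mult.assoc)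
    finally have "0 = (\<Sum>s\<in>T. c s * ((poly a (x s) + x s ^ P * poly b (x s)) * poly p (x s)))"
      by simp
    also have "\<dots> = (\<Sum>s\<in>{t}. c s * ((poly a (x s) + x s ^ P * poly b (x s)) * poly p (x s)))"
      using t T(1) p0 zero by (intro sum.mono_neutral_right) auto
    finally show ?thesis
      using p(2) nz[OF t] by simp
  qed (use zero t in auto)
  define H where "H = a ^ Q - Polynomial.smult ((-1) ^ Q) (monom 1 1 * b ^ Q)"
  \<comment> \<open>If both parts are nonzero, their degrees are 0 and 1 modulo \<open>Q\<close>, so
    they cannot cancel.\<close>
  have "H \<noteq> 0"
  proof
    assume "H = 0"
    then have eq: "a ^ Q = Polynomial.smult ((-1) ^ Q) (monom 1 1 * b ^ Q)"
      by (simp add: H_def)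
    show False
    proof (cases "b = 0")
      case True
      with eq ab \<open>Q \<ge> 2\<close> show False
        by (simp add: power_0_left)
    next
      case False
      have "degree a * Q = degree (a ^ Q)"
        using \<open>Q \<ge> 2\<close> by (cases "a = 0") (auto simp: degree_power_eq power_0_left)
      also have "\<dots> = Suc (degree b * Q)"
        unfolding eq using False by (simp add: degree_mult_eq degree_power_eq degree_monom_eq)
      finally have "(degree a * Q) mod Q = Suc (degree b * Q) mod Q"
        by simp
      with \<open>Q \<ge> 2\<close> show False
        by (simp add: mod_Suc)
    qed
  qed
  have "poly H (x t) = 0" if "t \<in> T" for t
  proof -
    have "poly a (x t) ^ Q = (- (x t ^ P * poly b (x t))) ^ Q"
      using on_T[OF that] by (metis eq_neg_iff_add_eq_0)
    also have "\<dots> = (-1) ^ Q * (x t * poly b (x t) ^ Q)"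
      using PQ[OF that] by (simp add: power_minus[of "_ * _"] power_mult_distrib power_mult)
    finally show ?thesis
      by (simp add: H_def poly_monom)
  qed
  then have "x ` T \<subseteq> {y. poly H y = 0}"
    by auto
  then have "card (x ` T) \<le> card {y. poly H y = 0}"
    by (intro card_mono poly_roots_finite \<open>H \<noteq> 0\<close>)
  also have "\<dots> \<le> degree H"
    using \<open>H \<noteq> 0\<close> by (rule card_poly_roots_bound)
  also have "\<dots> \<le> Q * K + 1"
  proof -
    have pow: "degree (p ^ Q) \<le> Q * K" if "degree p \<le> K" for p :: "'b poly"
    proof -
      have "degree (p ^ Q) \<le> degree p * Q"
        by (rule degree_power_le)
      also have "\<dots> \<le> K * Q"
        using that by (rule mult_le_mono1)
      finally show ?thesis
        by (simp add: mult.commute)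
    qed
    have "degree (a ^ Q) \<le> Q * K"
      by (rule pow[OF deg(1)])
    moreover have "degree (monom 1 1 * b ^ Q) \<le> 1 + Q * K"
      using pow[OF deg(2)] by (intro order_trans[OF degree_mult_le] add_mono degree_monom_le)
    ultimately show ?thesis
      unfolding H_def by (intro degree_diff_le order_trans[OF degree_smult_le]) auto
  qed
  finally show ?thesis
    using T(3) by (simp add: card_image K_def)
qed

section \<open>Exponents of a primitive root: conjugates of the designed zeros avoid the
  runs\<close>

lemma primitive_root_power_ne_1:
  "primitive_root_of_unity n \<beta> \<Longrightarrow> 0 < e \<Longrightarrow> e < n \<Longrightarrow> \<beta> ^ e \<noteq> 1"
  by (auto simp: primitive_root_of_unity_def)

text \<open>
  Multiplication of exponents by \<open>b\<close> is a rotation of their \<open>2 * m\<close> digits in base \<open>b\<close>; rotating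
  either \<open>i\<close> or \<open>j\<close> by at most \<open>m - 1\<close> places makes the exponent smaller than \<open>n\<close>.
\<close>

lemma power_in_run_ne_conjugate:
  fixes \<beta> :: "'b::field"
  assumes \<beta>: "primitive_root_of_unity n \<beta>" and n: "n + 1 = b ^ (2 * m)"
    and m: "even m" "m > 0" and b: "b \<ge> 2"
    and i: "1 \<le> i" "i + 2 * b ^ 2 \<le> b ^ (m + 1)"
    and r: "odd r" "r < 2 * m"
    and j: "j \<le> J \<or> (b ^ (m + 1) \<le> j \<and> j \<le> b ^ (m + 1) + J)"
    and J1: "J + 1 < b ^ (m + 1)"
    and J2: "J * b ^ (m - 1) + b ^ (m + 1) + 2 < b ^ (2 * m) + 2 * b ^ 2"
  shows "\<beta> ^ (j + i * b ^ r) \<noteq> 1"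
proof
  assume eq: "\<beta> ^ (j + i * b ^ r) = 1"
  have \<beta>b: "\<beta> ^ (b ^ (2 * m)) = \<beta>"
    using \<beta> by (simp flip: n add: primitive_root_of_unity_def)
  have Pb: "b ^ (m + 1) * b ^ (m - 1) = b ^ (2 * m)"
    using m by (subst power_add[symmetric]) (simp add: mult_2)
  have jle: "j \<le> b ^ (m + 1) + J"
    using j by auto
  show False
  proof (cases "r \<le> m - 1")
    case True
    \<comment> \<open>The margin \<open>2 * b ^ 2\<close> in the bound on \<open>i\<close> grows to
      \<open>2 * b ^ (m + 1)\<close> under multiplication by \<open>b ^ (m - 1)\<close>, which makes
      room for \<open>j\<close>.\<close>
    have "b ^ r \<le> b ^ (m - 1)"
      using b True by (intro power_increasing) auto
    then have "i * b ^ r + 2 * b ^ 2 * b ^ (m - 1) \<le> (i + 2 * b ^ 2) * b ^ (m - 1)"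
      by (simp add: add_mult_distrib)
    also have "\<dots> \<le> b ^ (2 * m)"
      using mult_le_mono1[OF i(2), of "b ^ (m - 1)"] by (simp only: Pb)
    also have "2 * b ^ 2 * b ^ (m - 1) = 2 * b ^ (m + 1)"
      using m by (subst mult.assoc, subst power_add[symmetric]) simp
    finally have "j + i * b ^ r < n"
      using jle J1 n by linarith
    moreover have "j + i * b ^ r > 0"
      using i b by simp
    ultimately show False
      using eq primitive_root_power_ne_1[OF \<beta>, of "j + i * b ^ r"] by (simp only:)
  next
    case False
    define s where "s = 2 * m - r"
    \<comment> \<open>By parity; hence \<open>r\<close> exceeds \<open>m\<close>, and the
      complementary rotation by \<open>s\<close> is at most \<open>m - 1\<close> places.\<close>
    have "r \<noteq> m"
      using m r by auto
    then have s: "s \<le> m - 1" "r + s = 2 * m" "odd s"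
      using False r m by (auto simp: s_def)
    have "b ^ r * b ^ s = b ^ (2 * m)"
      by (metis power_add s(2))
    then have expo: "(j + i * b ^ r) * b ^ s = j * b ^ s + b ^ (2 * m) * i"
      by (simp only: add_mult_distrib mult.assoc mult.commute[of i "b ^ (2 * m)"])
    have "1 = (\<beta> ^ (j + i * b ^ r)) ^ b ^ s"
      by (simp add: eq)
    also have "\<dots> = \<beta> ^ (j * b ^ s) * (\<beta> ^ b ^ (2 * m)) ^ i"
      unfolding power_mult[symmetric] power_add[symmetric] expo ..
    also have "\<dots> = \<beta> ^ (j * b ^ s + i)"
      by (simp add: \<beta>b power_add)
    finally have eq': "\<beta> ^ (j * b ^ s + i) = 1"
      by simp
    have bs: "b ^ s \<le> b ^ (m - 1)"
      using b s by (intro power_increasing) auto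
    have small: "l * b ^ s + i + 1 < n" if "l \<le> J" for l
    proof -
      have "l * b ^ s \<le> J * b ^ (m - 1)"
        using that bs by (rule mult_le_mono)
      then show ?thesis
        using J2 i(2) n by linarith
    qed
    show False
    proof (cases "j \<le> J")
      case True
      then show False
        using small[of j] eq' i primitive_root_power_ne_1[OF \<beta>, of "j * b ^ s + i"] by simp
    next
      case False
      then obtain l where l: "j = b ^ (m + 1) + l" "l \<le> J"
        using j by (metis add_le_cancel_left le_Suc_ex)
      show False
      proof (cases "s = m - 1")
        case True
        \<comment> \<open>The summand \<open>b ^ (m + 1)\<close> of \<open>j\<close> rotates to
          \<open>b ^ (2 * m)\<close>, which acts as the exponent 1. This is the \<open>+ 1\<close>
          provided for in \<open>small\<close>.\<close>
        have "j * b ^ s + i = b ^ (2 * m) + (l * b ^ s + i)"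
          by (simp only: l add_mult_distrib True Pb add.assoc)
        then have "\<beta> ^ (l * b ^ s + i + 1) = 1"
          using eq' \<beta>b by (simp add: power_add mult_ac)
        then show False
          using small[OF l(2)] primitive_root_power_ne_1[OF \<beta>, of "l * b ^ s + i + 1"] by simp
      next
        case False
        \<comment> \<open>Both \<open>s\<close> and \<open>m - 1\<close> are odd, so they differ by
          at least 2.\<close>
        with s m have s3: "s + 3 \<le> m"
          by (cases "s + 2 = m") auto
        have "b ^ s * 2 ^ 2 \<le> b ^ s * b ^ 2"
          using b by (intro mult_le_mono power_mono) auto
        also have "\<dots> \<le> b ^ (m - 1)"
          unfolding power_add[symmetric] using s3 b by (intro power_increasing) auto
        finally have "b ^ (m + 1) * (b ^ s * 4) \<le> b ^ (2 * m)"
          unfolding Pb[symmetric] by (intro mult_le_mono) auto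
        moreover have "l * b ^ s \<le> b ^ (m + 1) * b ^ s"
          using l J1 by (intro mult_le_mono) auto
        moreover have "i + 1 < b ^ (m + 1) * b ^ s"
        proof -
          have "b ^ (m + 1) * 1 \<le> b ^ (m + 1) * b ^ s"
            using b by (intro mult_le_mono) auto
          moreover have "b ^ 2 \<ge> 1"
            using b by simp
          ultimately show ?thesis
            using i(2) by linarith
        qed
        ultimately have "j * b ^ s + i < n"
          unfolding l add_mult_distrib using n by linarith
        then show False
          using eq' i primitive_root_power_ne_1[OF \<beta>, of "j * b ^ s + i"] by simp
      qed
    qed
  qed
qed

subsection \<open>Hermitian duals of cyclic codes\<close>

text \<open>Reversing \<open>p\<close> turns the inner product with a shift of \<open>p\<close> into
  a convolution, that is, into one coefficient of a product.\<close>

lemma sum_coeff_monom_mult: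
  fixes c p :: "'a::field poly"
  assumes "s + degree p < N"
  shows "(\<Sum>i<N. coeff c i * coeff (monom 1 s * p) i) = coeff (c * reflect_poly p) (s + degree p)"
proof -
  have "(\<Sum>i<N. coeff c i * coeff (monom 1 s * p) i) =
    (\<Sum>i\<le>s + degree p. coeff c i * coeff (monom 1 s * p) i)"
    using assms
    by (intro sum.mono_neutral_right) (auto simp: coeff_monom_mult coeff_eq_0)
  also have "\<dots> = (\<Sum>i\<le>s + degree p. coeff c i * coeff (reflect_poly p) (s + degree p - i))"
  proof (intro sum.cong refl)
    fix i
    assume "i \<in> {..s + degree p}"
    then have "degree p - (s + degree p - i) = i - s" if "s \<le> i"
      using that by auto
    with \<open>i \<in> _\<close> show "coeff c i * coeff (monom 1 s * p) i =
        coeff c i * coeff (reflect_poly p) (s + degree p - i)"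
      by (cases "s \<le> i") (auto simp: coeff_monom_mult coeff_reflect_poly)
  qed
  finally show ?thesis
    by (simp add: coeff_mult)
qed

text \<open>Conjugation in the Hermitian form enters only as an involutive field
  homomorphism.\<close>

locale hermitian_conj =
  fixes r :: nat and field_type :: "'a::field itself"
  assumes hom: "field_hom (\<lambda>a::'a. a ^ r)"
    and invol: "\<And>a::'a. (a ^ r) ^ r = a"
begin

sublocale conj: field_hom "\<lambda>a::'a. a ^ r"
  by (rule hom)

sublocale map_poly_conj: map_poly_inj_idom_hom "\<lambda>a::'a. a ^ r"
  ..

text \<open>The conjugate reciprocal polynomial. It keeps the degree when the constant coefficient
  is nonzero, as it is for divisors of x^N - 1.\<close>

definition recip :: "'a poly \<Rightarrow> 'a poly" where
  "recip p = reflect_poly (map_poly (\<lambda>a. a ^ r) p)"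

lemma recip_mult: "recip (p * q) = recip p * recip q"
  by (simp add: recip_def map_poly_conj.hom_mult reflect_poly_mult)

lemma recip_smult: "recip (Polynomial.smult a p) = Polynomial.smult (a ^ r) (recip p)"
  by (simp add: recip_def conj.map_poly_hom_smult reflect_poly_smult)

lemma map_conj_conj: "map_poly (\<lambda>a. a ^ r) (map_poly (\<lambda>a. a ^ r) p) = (p :: 'a poly)"
  by (rule poly_eqI) (simp add: invol)

lemma map_conj_reflect_poly:
  "map_poly (\<lambda>a. a ^ r) (reflect_poly p) = reflect_poly (map_poly (\<lambda>a. a ^ r) (p :: 'a poly))"
  by (rule poly_eqI) (auto simp: coeff_reflect_poly)

lemma recip_recip: "coeff p 0 \<noteq> 0 \<Longrightarrow> recip (recip p) = p"
  by (simp add: recip_def map_conj_reflect_poly map_conj_conj)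

lemma degree_recip: "coeff p 0 \<noteq> 0 \<Longrightarrow> degree (recip p) = degree p"
  by (simp add: recip_def)

lemma recip_monom_diff_1:
  assumes "N > 0"
  shows "recip (monom 1 N - 1) = 1 - monom 1 N"
proof -
  have "map_poly (\<lambda>a. a ^ r) (monom 1 N - 1) = (monom 1 N - 1 :: 'a poly)"
    by (simp add: map_poly_conj.hom_minus)
  moreover have "reflect_poly (monom 1 N - 1) = (1 - monom 1 N :: 'a poly)"
    using assms degree_monom_diff_1[OF assms, where 'a='a]
    by (intro poly_eqI) (auto simp: coeff_reflect_poly coeff_1)
  ultimately show ?thesis
    by (simp add: recip_def)
qed

context
  fixes g h :: "'a poly" and N :: nat
  assumes gh: "g * h = monom 1 N - 1" and N: "N > 0"
begin

lemma cofactor_nz: "g \<noteq> 0" "h \<noteq> 0"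
  using gh degree_monom_diff_1(2)[OF N, where 'a='a] by auto

lemma cofactor_degree: "degree g + degree h = N"
  using degree_mult_eq[OF cofactor_nz] gh degree_monom_diff_1(1)[OF N, where 'a='a] by simp

lemma cofactor_coeff_0: "coeff g 0 \<noteq> 0" "coeff h 0 \<noteq> 0"
proof -
  have "coeff (g * h) 0 = -1"
    using N by (simp add: gh)
  then show "coeff g 0 \<noteq> 0" "coeff h 0 \<noteq> 0"
    by (auto simp: coeff_mult)
qed

lemma recip_cofactor: "recip g * recip h = 1 - monom 1 N"
  using recip_mult[of g h] gh N by (simp add: recip_monom_diff_1)

lemma sum_conj_shift:
  assumes "s < degree h"
  shows "(\<Sum>i<N. coeff c i * coeff (monom 1 s * map_poly (\<lambda>a. a ^ r) g) i) =
    coeff (c * recip g) (s + degree g)"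
  using sum_coeff_monom_mult[of s "map_poly (\<lambda>a. a ^ r) g" N c] assms cofactor_degree
  by (simp add: recip_def)

text \<open>Orthogonality to the shifts of \<open>g\<close> kills the coefficients of
  \<open>c * recip g\<close> from \<open>degree g\<close> to \<open>N - 1\<close>. Folded modulo x^N
  - 1, the product is a multiple of \<open>recip g\<close> of too small degree, hence 0. So x^N - 1
  divides \<open>c * recip g\<close>, and cancelling \<open>recip g\<close> leaves
  \<open>recip h\<close>.\<close>

lemma recip_dvd_if_orthogonal:
  assumes c: "degree c < N"
    and orth: "\<And>t. degree (g * t) < N \<Longrightarrow> (\<Sum>i<N. coeff c i * coeff (g * t) i ^ r) = 0"
  shows "recip h dvd c"
proof -
  define p where "p = c * recip g"
  have mid: "coeff p i = 0" if "degree g \<le> i" "i < N" for i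
  proof -
    define s where "s = i - degree g"
    have s: "i = s + degree g" "s < degree h"
      using that cofactor_degree by (auto simp: s_def)
    have "degree (g * monom 1 s) < N"
      using s that cofactor_nz by (simp add: degree_mult_eq degree_monom_eq)
    from orth[OF this]
    have "(\<Sum>i<N. coeff c i * coeff (map_poly (\<lambda>a. a ^ r) (g * monom 1 s)) i) = 0"
      by simp
    with sum_conj_shift[OF s(2), of c] show ?thesis
      by (simp add: p_def s(1) map_poly_conj.hom_mult mult.commute)
  qed
  have top: "coeff p (N + i) = 0" if "degree g \<le> i" for i
  proof -
    have "degree p < N + degree g"
      unfolding p_def using degree_mult_le[of c "recip g"] c cofactor_coeff_0
      by (simp add: degree_recip)
    with that show ?thesis
      by (intro coeff_eq_0) auto
  qed
  \<comment> \<open>The sum \<open>lo + hi\<close> is the residue of \<open>p\<close> modulo x^N -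
    1.\<close>
  define lo hi where "lo = poly_cutoff N p" and "hi = poly_shift N p"
  have p: "p = lo + monom 1 N * hi"
    by (rule poly_eqI) (auto simp: lo_def hi_def coeff_poly_cutoff coeff_poly_shift coeff_monom_mult)
  have "coeff (lo + hi) i = 0" if "degree g \<le> i" for i
    using mid[OF that] top[OF that]
    by (simp add: lo_def hi_def coeff_poly_cutoff coeff_poly_shift add.commute)
  moreover have "recip g dvd lo + hi"
  proof -
    have "lo + hi = p + (1 - monom 1 N) * hi"
      by (simp add: p algebra_simps)
    then show ?thesis
      by (simp add: p_def flip: recip_cofactor)
  qed
  moreover have "degree (recip g) = degree g"
    using cofactor_coeff_0 by (simp add: degree_recip)
  ultimately have "lo + hi = 0"
    by (metis dvd_imp_degree_le leading_coeff_0_iff)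
  then have "hi = - lo"
    by (simp add: eq_neg_iff_add_eq_0 add.commute)
  then have "p = (1 - monom 1 N) * lo"
    by (simp add: p left_diff_distrib)
  then have "p = recip g * (recip h * lo)"
    by (simp only: mult.assoc flip: recip_cofactor)
  then have "c = recip h * lo"
    using cofactor_nz by (simp add: p_def recip_def mult.commute)
  then show ?thesis
    by simp
qed

text \<open>Writing \<open>c = recip h * s\<close> gives
  \<open>c * recip g = (1 - monom 1 N) * s\<close> with \<open>degree s < degree g\<close>. Its
  coefficients between \<open>degree g\<close> and \<open>N - 1\<close> vanish; these are the
  products with the shifts of \<open>g\<close>, which span the multiples
  \<open>g * t\<close>.\<close>

lemma orthogonal_if_recip_dvd:
  assumes c: "degree c < N" and dvd: "recip h dvd c" and t: "degree (g * t) < N"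
  shows "(\<Sum>i<N. coeff c i * coeff (g * t) i ^ r) = 0"
proof (cases "c = 0 \<or> t = 0")
  case True
  \<comment> \<open>For \<open>r = 0\<close> the map would send 0 to \<open>0 ^ 0 = 1\<close> and
    not be a homomorphism.\<close>
  have "r > 0"
    using conj.hom_zero by (cases r) auto
  with True show ?thesis
    by auto
next
  case False
  let ?g = "map_poly (\<lambda>a. a ^ r) g" and ?t = "map_poly (\<lambda>a. a ^ r) t"
  obtain s where s: "c = recip h * s"
    using dvd by blast
  with False have "s \<noteq> 0"
    by auto
  have "degree h + degree s < N"
    using c False \<open>s \<noteq> 0\<close> cofactor_coeff_0
    by (simp add: s degree_mult_eq recip_def)
  then have deg_s: "degree s < degree g"
    using cofactor_degree by simp
  have cg: "c * recip g = (1 - monom 1 N) * s"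
    by (simp add: s mult_ac flip: recip_cofactor)
  have shift: "(\<Sum>i<N. coeff c i * coeff (monom 1 l * ?g) i) = 0" if "l \<le> degree t" for l
  proof -
    have l: "l < degree h"
      using that t False cofactor_nz cofactor_degree by (simp add: degree_mult_eq)
    then have "l + degree g < N"
      using cofactor_degree by simp
    then show ?thesis
      using deg_s unfolding sum_conj_shift[OF l] cg
      by (simp add: left_diff_distrib coeff_monom_mult coeff_eq_0)
  qed
  have "?g * ?t = ?g * (\<Sum>l\<le>degree t. monom (coeff ?t l) l)"
    using poly_as_sum_of_monoms[of ?t] by simp
  also have "\<dots> = (\<Sum>l\<le>degree t. Polynomial.smult (coeff ?t l) (monom 1 l * ?g))"
    by (simp add: sum_distrib_left smult_monom mult.commute flip: mult_smult_left)
  finally have gt: "?g * ?t = (\<Sum>l\<le>degree t. Polynomial.smult (coeff ?t l) (monom 1 l * ?g))" .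
  have "(\<Sum>i<N. coeff c i * coeff (g * t) i ^ r) = (\<Sum>i<N. coeff c i * coeff (?g * ?t) i)"
    by (simp flip: map_poly_conj.hom_mult)
  also have "\<dots> = (\<Sum>l\<le>degree t. coeff ?t l * (\<Sum>i<N. coeff c i * coeff (monom 1 l * ?g) i))"
    unfolding gt coeff_sum sum_distrib_left by (subst sum.swap) (simp add: mult_ac)
  also have "\<dots> = 0"
    using shift by (intro sum.neutral) simp
  finally show ?thesis .
qed

lemma hermitian_dual_code_generated_by:
  "hermitian_dual r N (code_generated_by N g) = {c \<in> carrier_vec N. recip h dvd word_poly c}"
proof -
  have prod: "hermitian_prod r c y = (\<Sum>i<N. coeff (word_poly c) i * coeff (word_poly y) i ^ r)"
    if "c \<in> carrier_vec N" "y \<in> carrier_vec N" for c y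
    using that by (auto simp: hermitian_prod_def coeff_word_poly)
  have code: "code_generated_by N g = {y \<in> carrier_vec N. g dvd word_poly y}"
    using N gh by (intro code_generated_by_dvd) (auto intro: dvdI simp flip: gh)
  have "recip h dvd word_poly c"
    if c: "c \<in> carrier_vec N"
      and orth: "\<And>y. y \<in> carrier_vec N \<Longrightarrow> g dvd word_poly y \<Longrightarrow> hermitian_prod r c y = 0" for c
  proof (rule recip_dvd_if_orthogonal)
    show "degree (word_poly c) < N"
      using c N by (simp add: degree_word_poly)
    fix t
    assume t: "degree (g * t) < N"
    then show "(\<Sum>i<N. coeff (word_poly c) i * coeff (g * t) i ^ r) = 0"
      using orth[of "vec N (coeff (g * t))"] prod[OF c, of "vec N (coeff (g * t))"]
      by (simp add: word_poly_vec_coeff)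
  qed
  moreover have "hermitian_prod r c y = 0"
    if "c \<in> carrier_vec N" "recip h dvd word_poly c" "y \<in> carrier_vec N" "g dvd word_poly y" for c y
  proof -
    obtain t where t: "word_poly y = g * t"
      using \<open>g dvd word_poly y\<close> by blast
    have "degree (word_poly c) < N" "degree (word_poly y) < N"
      using that N by (simp_all add: degree_word_poly)
    then show ?thesis
      using orthogonal_if_recip_dvd[of "word_poly c" t] that by (simp add: prod t)
  qed
  ultimately show ?thesis
    unfolding hermitian_dual_def code by blast
qed

lemma generator_hermitian_dual:
  defines "u \<equiv> inverse (lead_coeff (recip h))"
  shows "is_generator_poly N (hermitian_dual r N (code_generated_by N g)) (Polynomial.smult u (recip h))"
    and "u \<noteq> 0"
proof -
  have nz: "recip h \<noteq> 0"
    using cofactor_nz by (simp add: recip_def)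
  then show u: "u \<noteq> 0"
    by (simp add: u_def)
  have "monom 1 N - 1 = recip h * - recip g"
    using recip_cofactor by (simp add: algebra_simps)
  then have "recip h dvd monom 1 N - 1"
    by simp
  with u nz show "is_generator_poly N (hermitian_dual r N (code_generated_by N g))
      (Polynomial.smult u (recip h))"
    unfolding is_generator_poly_def
    by (simp add: hermitian_dual_code_generated_by code_generated_by_dvd N smult_dvd_iff u_def)
qed

end

text \<open>In characteristic 2, x^(2N) - 1 is the square of x^N - 1, so the cofactor of
  \<open>g * gp\<close> is \<open>h * hp\<close>. Its conjugate reciprocal is again
  \<open>g * gp\<close> up to a unit, because \<open>recip\<close> exchanges the roles of the
  factors.\<close>

lemma hermitian_self_dual_double:
  assumes gh: "g * h = monom 1 N - 1" and N: "N > 0"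
    and two: "(2 :: 'a) = 0" and u: "u \<noteq> 0" and gp: "gp = Polynomial.smult u (recip h)"
  shows "hermitian_self_dual r (2 * N) (code_generated_by (2 * N) (g * gp))"
    and "g * gp dvd monom 1 (2 * N) - 1"
proof -
  \<comment> \<open>The cofactor of \<open>gp\<close>; the sign comes from
    \<open>recip g * recip h = 1 - monom 1 N\<close>.\<close>
  define hp where "hp = Polynomial.smult (- inverse u) (recip g)"
  have gp_hp: "gp * hp = monom 1 N - 1"
    using recip_cofactor[OF gh N] u by (simp add: gp hp_def mult.commute)
  have double: "p + p = 0" for p :: "'a poly"
  proof (rule poly_eqI)
    fix i
    show "coeff (p + p) i = coeff 0 i"
      unfolding coeff_add coeff_0 by (metis mult_2 mult_zero_left two)
  qed
  have "(g * gp) * (h * hp) = (g * h) * (gp * hp)"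
    by (simp only: mult_ac)
  also have "\<dots> = (monom 1 N - 1) * (monom 1 N - 1)"
    unfolding gh gp_hp ..
  also have "\<dots> = monom 1 (2 * N) - 1"
  proof -
    have "(X - 1) * (X - 1) = X * X - 1 - (X + X) + (1 + 1)" for X :: "'a poly"
      by (simp add: algebra_simps)
    then show ?thesis
      unfolding double by (simp add: mult_monom mult_2)
  qed
  finally have fact: "(g * gp) * (h * hp) = monom 1 (2 * N) - 1" .
  then show dvd: "g * gp dvd monom 1 (2 * N) - 1"
    by (metis dvd_triv_left)
  have "recip (h * hp) = recip h * Polynomial.smult ((- inverse u) ^ r) g"
    by (simp only: hp_def recip_mult recip_smult recip_recip cofactor_coeff_0[OF gh N] not_False_eq_True)
  also have "\<dots> = Polynomial.smult ((- inverse u) ^ r * inverse u) (g * gp)"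
    using u by (simp add: gp mult.commute[of g "recip h"] mult.assoc[of _ "inverse u" u])
  finally have "recip (h * hp) = Polynomial.smult ((- inverse u) ^ r * inverse u) (g * gp)" .
  moreover have "(- inverse u) ^ r * inverse u \<noteq> 0"
    using u by simp
  ultimately have "recip (h * hp) dvd p \<longleftrightarrow> g * gp dvd p" for p
    by (simp add: smult_dvd_iff)
  then show "hermitian_self_dual r (2 * N) (code_generated_by (2 * N) (g * gp))"
    unfolding hermitian_self_dual_def
    using hermitian_dual_code_generated_by[OF fact] N dvd
    by (simp add: code_generated_by_dvd)
qed

end

subsection \<open>Minimum distances\<close>

definition poly_code :: "nat \<Rightarrow> 'a::field poly \<Rightarrow> 'a vec set" where
  "poly_code N g = {c \<in> carrier_vec N. g dvd word_poly c}"

definition poly_weight :: "'a::zero poly \<Rightarrow> nat" where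
  "poly_weight p = card {i. coeff p i \<noteq> 0}"

lemma finite_poly_support: "finite {i. coeff p i \<noteq> 0}"
  by (rule finite_subset[of _ "{..degree p}"]) (auto intro: le_degree)

lemma hamming_dist_eq_poly_weight:
  assumes "x \<in> carrier_vec N" "y \<in> carrier_vec N"
  shows "hamming_dist x y = poly_weight (word_poly x - word_poly y)"
  using assms unfolding hamming_dist_def poly_weight_def
  by (intro arg_cong[where f = card]) (auto simp: coeff_word_poly split: if_splits)

lemma min_distance_poly_code_le:
  assumes "p \<noteq> 0" "degree p < N" "g dvd p"
  shows "min_distance (poly_code N g) \<le> poly_weight p"
proof -
  let ?c = "vec N (coeff p)"
  have "?c \<in> poly_code N g" "0\<^sub>v N \<in> poly_code N g"
    using assms by (simp_all add: poly_code_def word_poly_vec_coeff)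
  moreover have "?c \<noteq> 0\<^sub>v N"
    using assms by (metis word_poly_vec_coeff word_poly_zero)
  moreover have "poly_weight p = hamming_dist ?c (0\<^sub>v N)"
    using assms by (subst hamming_dist_eq_poly_weight[of _ N]) (auto simp: word_poly_vec_coeff)
  ultimately show ?thesis
    unfolding min_distance_def by (intro Least_le) blast
qed

text \<open>The polynomial \<open>p\<close> witnesses a nonzero word, so that the
  \<open>LEAST\<close> in \<open>min_distance\<close> ranges over a nonempty set.\<close>

lemma min_distance_poly_code_attained:
  assumes "p \<noteq> 0" "degree p < N" "g dvd p"
  obtains p' where "p' \<noteq> 0" "degree p' < N" "g dvd p'" "poly_weight p' = min_distance (poly_code N g)"
proof -
  let ?P = "\<lambda>d. \<exists>x\<in>poly_code N g. \<exists>y\<in>poly_code N g. x \<noteq> y \<and> d = hamming_dist x y"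
  have "N > 0"
    using assms by simp
  have "vec N (coeff p) \<in> poly_code N g" "0\<^sub>v N \<in> poly_code N g" "vec N (coeff p) \<noteq> 0\<^sub>v N"
    using assms by (auto simp: poly_code_def word_poly_vec_coeff) (metis word_poly_vec_coeff word_poly_zero)
  then have "\<exists>d. ?P d"
    by blast
  then have "?P (min_distance (poly_code N g))"
    unfolding min_distance_def by (rule LeastI_ex)
  then obtain x y where xy: "x \<in> poly_code N g" "y \<in> poly_code N g" "x \<noteq> y"
    "min_distance (poly_code N g) = hamming_dist x y"
    by blast
  show thesis
  proof
    show "word_poly x - word_poly y \<noteq> 0"
      using xy word_poly_eq_iff[of x N y] by (auto simp: poly_code_def)
    show "degree (word_poly x - word_poly y) < N"
      using xy \<open>N > 0\<close> by (intro degree_diff_less) (auto simp: poly_code_def degree_word_poly)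
    show "g dvd word_poly x - word_poly y"
      using xy by (auto simp: poly_code_def)
    show "poly_weight (word_poly x - word_poly y) = min_distance (poly_code N g)"
      using xy by (subst hamming_dist_eq_poly_weight[symmetric, of _ N]) (auto simp: poly_code_def)
  qed
qed

lemma poly_weight_append:
  fixes lo hi :: "'a::comm_ring_1 poly"
  assumes "\<And>i. i \<ge> N \<Longrightarrow> coeff lo i = 0"
  shows "poly_weight (lo + monom 1 N * hi) = poly_weight lo + poly_weight hi"
proof -
  have "{i. coeff (lo + monom 1 N * hi) i \<noteq> 0} =
      {i. coeff lo i \<noteq> 0} \<union> (\<lambda>i. i + N) ` {i. coeff hi i \<noteq> 0}" (is "?L = ?R")
  proof (rule Set.set_eqI)
    fix i
    show "i \<in> ?L \<longleftrightarrow> i \<in> ?R"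
    proof (cases "i < N")
      case True
      then show ?thesis
        by (auto simp: coeff_monom_mult)
    next
      case False
      then have "coeff lo i = 0" "i = (i - N) + N"
        using assms by auto
      with False show ?thesis
        by (auto simp: coeff_monom_mult image_iff)
    qed
  qed
  moreover have "{i. coeff lo i \<noteq> 0} \<inter> (\<lambda>i. i + N) ` {i. coeff hi i \<noteq> 0} = {}"
    using assms by fastforce
  ultimately show ?thesis
    by (simp add: poly_weight_def card_Un_disjoint card_image finite_poly_support)
qed

lemma poly_weight_uminus: "poly_weight (- p) = poly_weight (p :: 'a::ab_group_add poly)"
  by (simp add: poly_weight_def)

lemma poly_weight_add_le: "poly_weight (p + q) \<le> poly_weight p + poly_weight (q :: 'a::comm_monoid_add poly)"
proof -
  have "poly_weight (p + q) \<le> card ({i. coeff p i \<noteq> 0} \<union> {i. coeff q i \<noteq> 0})"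
    unfolding poly_weight_def by (intro card_mono finite_UnI finite_poly_support) auto
  also have "\<dots> \<le> poly_weight p + poly_weight q"
    unfolding poly_weight_def by (rule card_Un_le)
  finally show ?thesis .
qed

lemma power2_sum_char_2:
  fixes f :: "'i \<Rightarrow> 'a::comm_ring_1"
  assumes "(2 :: 'a) = 0" "finite I"
  shows "(\<Sum>i\<in>I. f i)\<^sup>2 = (\<Sum>i\<in>I. (f i)\<^sup>2)"
  using assms(2)
proof (induction I rule: finite_induct)
  case (insert i I)
  then show ?case
    using power_2_power_add[OF assms(1), of "f i" "sum f I" 1] by simp
qed simp

text \<open>In characteristic 2, squaring squares each coefficient and doubles its exponent, so no
  terms merge or vanish.\<close>

lemma poly_weight_power2:
  fixes p :: "'a::field poly"
  assumes "(2 :: 'a) = 0"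
  shows "poly_weight (p\<^sup>2) = poly_weight p"
proof -
  have "(2 :: 'a poly) = [:2:]"
    by (simp add: numeral_poly)
  then have "(2 :: 'a poly) = 0"
    using assms by simp
  then have "(\<Sum>i\<le>degree p. monom (coeff p i) i)\<^sup>2 = (\<Sum>i\<le>degree p. (monom (coeff p i) i)\<^sup>2)"
    by (intro power2_sum_char_2) auto
  then have p2: "p\<^sup>2 = (\<Sum>i\<le>degree p. monom ((coeff p i)\<^sup>2) (i * 2))"
    by (simp add: poly_as_sum_of_monoms monom_power)
  have "coeff (p\<^sup>2) k = (if even k then (coeff p (k div 2))\<^sup>2 else 0)" for k
  proof (cases "even k")
    case True
    then obtain l where l: "k = l * 2"
      by (metis dvd_def mult.commute)
    have "coeff (p\<^sup>2) k = (\<Sum>i\<le>degree p. if i = l then (coeff p i)\<^sup>2 else 0)"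
      unfolding p2 coeff_sum by (intro sum.cong) (auto simp: l)
    then show ?thesis
      using True l by (auto simp: coeff_eq_0)
  next
    case False
    then show ?thesis
      unfolding p2 coeff_sum by (auto intro!: sum.neutral)
  qed
  then have "{k. coeff (p\<^sup>2) k \<noteq> 0} = (\<lambda>i. 2 * i) ` {i. coeff p i \<noteq> 0}"
    by (auto simp: image_iff elim!: evenE)
  then show ?thesis
    by (simp add: poly_weight_def card_image inj_on_def)
qed

text \<open>
  This is van Lint's repeated-root construction: up to a permutation of coordinates the
  words of the code of length \<open>2 * N\<close> are those of the form \<open>(u | u + v)\<close>.
\<close>

lemma min_distance_double:
  fixes g gp :: "'a::field poly"
  assumes two: "(2 :: 'a) = 0" and N: "N > 0"
    and M: "gp * hp = monom 1 N - 1" and g: "g dvd gp"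
    and cancel: "\<And>p. g dvd hp * p \<Longrightarrow> g dvd p"
    and nontriv: "degree gp < N"
  shows "min_distance (poly_code (2 * N) (g * gp)) =
    min (2 * min_distance (poly_code N g)) (min_distance (poly_code N gp))" (is "?d = min (2 * ?d1) ?d2")
proof -
  have gp: "gp \<noteq> 0"
    using M degree_monom_diff_1(2)[OF N, where 'a='a] by auto
  obtain u where u: "u \<noteq> 0" "degree u < N" "g dvd u" "poly_weight u = ?d1"
    using gp nontriv g by (rule min_distance_poly_code_attained)
  obtain v where v: "v \<noteq> 0" "degree v < N" "gp dvd v" "poly_weight v = ?d2"
    using gp nontriv by (rule min_distance_poly_code_attained) auto
  have le1: "?d \<le> 2 * ?d1"
  proof -
    \<comment> \<open>The word (-u | u): a multiple of \<open>g * gp\<close>, since \<open>g\<close>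
      divides \<open>u\<close> and \<open>gp\<close> divides x^N - 1.\<close>
    have eq: "u * (monom 1 N - 1) = - u + monom 1 N * u"
      by (simp add: algebra_simps)
    have "?d \<le> poly_weight (u * (monom 1 N - 1))"
    proof (rule min_distance_poly_code_le)
      show "u * (monom 1 N - 1) \<noteq> 0"
        using u degree_monom_diff_1(2)[OF N] by simp
      show "degree (u * (monom 1 N - 1)) < 2 * N"
        using u degree_monom_diff_1[OF N, where 'a='a] by (simp add: degree_mult_eq)
      show "g * gp dvd u * (monom 1 N - 1)"
        using u M by (intro mult_dvd_mono) (auto simp flip: M)
    qed
    also have "\<dots> = 2 * ?d1"
      unfolding eq using u
      by (subst poly_weight_append) (auto simp: coeff_eq_0 poly_weight_uminus)
    finally show ?thesis .
  qed
  have le2: "?d \<le> ?d2"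
  proof -
    \<comment> \<open>The square of \<open>v\<close> is a multiple of \<open>gp * gp\<close>, hence
      of \<open>g * gp\<close>, and has the weight of \<open>v\<close>.\<close>
    have "?d \<le> poly_weight (v\<^sup>2)"
    proof (rule min_distance_poly_code_le)
      show "v\<^sup>2 \<noteq> 0" "degree (v\<^sup>2) < 2 * N"
        using v by (simp_all add: degree_power_eq)
      show "g * gp dvd v\<^sup>2"
        unfolding power2_eq_square using v g by (meson dvd_trans mult_dvd_mono)
    qed
    also have "\<dots> = ?d2"
      using v two by (simp add: poly_weight_power2)
    finally show ?thesis .
  qed
  have "g * gp dvd v\<^sup>2" "v\<^sup>2 \<noteq> 0" "degree (v\<^sup>2) < 2 * N"
    unfolding power2_eq_square using v g
    by (meson dvd_trans mult_dvd_mono, simp_all add: degree_mult_eq)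
  then obtain p where p: "p \<noteq> 0" "degree p < 2 * N" "g * gp dvd p" "poly_weight p = ?d"
    using min_distance_poly_code_attained by blast
  define lo hi where "lo = poly_cutoff N p" and "hi = poly_shift N p"
  have p_eq: "p = lo + monom 1 N * hi"
    by (rule poly_eqI) (auto simp: lo_def hi_def coeff_poly_cutoff coeff_poly_shift coeff_monom_mult)
  have "?d = poly_weight (lo + monom 1 N * hi)"
    using p(4) p_eq by simp
  also have "\<dots> = poly_weight lo + poly_weight hi"
    by (rule poly_weight_append) (simp add: lo_def coeff_poly_cutoff)
  finally have d: "?d = poly_weight lo + poly_weight hi" .
  have deg: "degree lo < N" "degree hi < N"
    using N p(2) by (auto intro!: degree_lessI simp: lo_def hi_def coeff_poly_cutoff coeff_poly_shift coeff_eq_0)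
  \<comment> \<open>If the fold \<open>lo + hi\<close> is nonzero, it is a word for
    \<open>gp\<close>. If it is 0, both halves agree up to sign, and after cancelling
    \<open>gp\<close> and \<open>hp\<close> each is a word for \<open>g\<close>.\<close>
  have "?d \<ge> 2 * ?d1 \<or> ?d \<ge> ?d2"
  proof (cases "lo + hi = 0")
    case True
    then have hi: "hi = - lo"
      by (simp add: eq_neg_iff_add_eq_0 add.commute)
    then have "p = - ((monom 1 N - 1) * lo)"
      by (simp add: p_eq algebra_simps)
    then have "p = gp * (- (hp * lo))"
      by (simp add: mult.assoc flip: M)
    with p(3) gp have "g dvd hp * lo"
      by (metis dvd_mult_cancel_left dvd_minus_iff mult.commute)
    then have "g dvd lo"
      by (rule cancel)
    moreover have "lo \<noteq> 0"
      using p(1) p_eq hi by auto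
    ultimately have "?d1 \<le> poly_weight lo"
      using deg by (intro min_distance_poly_code_le)
    then show ?thesis
      using d by (simp add: hi poly_weight_uminus)
  next
    case False
    have "gp dvd p - (monom 1 N - 1) * hi"
      using p(3) M by (intro dvd_diff) (auto dest: dvd_mult_right simp flip: M)
    also have "p - (monom 1 N - 1) * hi = lo + hi"
      by (simp add: p_eq algebra_simps)
    finally have "?d2 \<le> poly_weight (lo + hi)"
      using deg False by (intro min_distance_poly_code_le degree_add_less)
    then show ?thesis
      using d poly_weight_add_le[of lo hi] by simp
  qed
  with le1 le2 show ?thesis
    by (auto simp: min_def)
qed

subsection \<open>Dimensions\<close>

lemma (in vectorspace) card_carrier_eq_power_dim:
  assumes "finite (carrier V)"
  shows "card (carrier V) = card (carrier K) ^ dim"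
proof -
  have "span (carrier V) = carrier V"
    using in_own_span span_is_subset2 by blast
  then have "fin_dim"
    unfolding fin_dim_def using assms by blast
  then obtain B where B: "finite B" "basis B"
    using finite_basis_exists by blast
  then have BV: "B \<subseteq> carrier V"
    by (simp add: basis_def)
  have ex1: "\<exists>!a. a \<in> B \<rightarrow>\<^sub>E carrier K \<and> lincomb a B = v" if "v \<in> carrier V" for v
    using basis_criterion[OF B(1) BV] B(2) that by simp
  have closed: "lincomb a B \<in> carrier V" if "a \<in> B \<rightarrow>\<^sub>E carrier K" for a
    using that B BV by (intro lincomb_closed) (auto simp: PiE_def)
  have "bij_betw (\<lambda>a. lincomb a B) (B \<rightarrow>\<^sub>E carrier K) (carrier V)"
    unfolding bij_betw_def inj_on_def
  proof (intro conjI ballI impI Set.set_eqI iffI)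
    show "a = a'" if "a \<in> B \<rightarrow>\<^sub>E carrier K" "a' \<in> B \<rightarrow>\<^sub>E carrier K" "lincomb a B = lincomb a' B" for a a'
      using that ex1[OF closed[OF that(1)]] by auto
    show "v \<in> carrier V" if "v \<in> (\<lambda>a. lincomb a B) ` (B \<rightarrow>\<^sub>E carrier K)" for v
      using that closed by blast
    show "v \<in> (\<lambda>a. lincomb a B) ` (B \<rightarrow>\<^sub>E carrier K)" if "v \<in> carrier V" for v
      using ex1[OF that] by blast
  qed
  then have "card (B \<rightarrow>\<^sub>E carrier K) = card (carrier V)"
    by (rule bij_betw_same_card)
  then show ?thesis
    using B by (simp add: card_PiE dim_basis)
qed

lemma card_poly_code:
  fixes g :: "'a::{field,finite} poly"
  assumes "g \<noteq> 0" "degree g \<le> N" "N > 0"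
  shows "card (poly_code N g) = CARD('a) ^ (N - degree g)"
proof -
  let ?S = "{t :: 'a poly. \<forall>i\<ge>N - degree g. coeff t i = 0}"
  have deg: "degree (g * t) < N \<longleftrightarrow> t \<in> ?S" if "t \<noteq> 0" for t
  proof
    assume "degree (g * t) < N"
    then show "t \<in> ?S"
      using assms that by (auto simp: degree_mult_eq coeff_eq_0)
  next
    assume "t \<in> ?S"
    then have "degree t < N - degree g"
      using that by (metis (mono_tags, lifting) leading_coeff_0_iff mem_Collect_eq not_le)
    then show "degree (g * t) < N"
      using assms that by (simp add: degree_mult_eq)
  qed
  have word: "word_poly (vec N (coeff (g * t))) = g * t" if "t \<in> ?S" for t
    using that deg[of t] \<open>N > 0\<close> by (cases "t = 0") (auto intro!: word_poly_vec_coeff)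
  have "bij_betw (\<lambda>t. vec N (coeff (g * t))) ?S (poly_code N g)"
    unfolding bij_betw_def
  proof (intro conjI)
    show "inj_on (\<lambda>t. vec N (coeff (g * t))) ?S"
    proof (rule inj_onI)
      fix t t'
      assume t: "t \<in> ?S" "t' \<in> ?S" and "vec N (coeff (g * t)) = vec N (coeff (g * t'))"
      then have "g * t = g * t'"
        using word[OF t(1)] word[OF t(2)] by metis
      with assms(1) show "t = t'"
        by (simp only: mult_cancel_left) simp
    qed
    show "(\<lambda>t. vec N (coeff (g * t))) ` ?S = poly_code N g"
    proof (intro equalityI subsetI)
      fix c
      assume "c \<in> poly_code N g"
      then obtain t where c: "c \<in> carrier_vec N" "word_poly c = g * t"
        by (auto simp: poly_code_def elim!: dvdE)
      have "degree (g * t) < N"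
        using c \<open>N > 0\<close> by (metis carrier_vecD degree_word_poly)
      then have t: "t \<in> ?S"
        using deg[of t] by (cases "t = 0") auto
      moreover have "c = vec N (coeff (g * t))"
        using word[OF t] c by (metis vec_carrier word_poly_eq_iff)
      ultimately show "c \<in> (\<lambda>t. vec N (coeff (g * t))) ` ?S"
        by blast
    next
      fix c
      assume "c \<in> (\<lambda>t. vec N (coeff (g * t))) ` ?S"
      then obtain t where "t \<in> ?S" "c = vec N (coeff (g * t))"
        by blast
      then show "c \<in> poly_code N g"
        using word by (simp add: poly_code_def)
    qed
  qed
  then have "card ?S = card (poly_code N g)"
    by (rule bij_betw_same_card)
  then show ?thesis
    unfolding card_poly_degree_less ..
qed

text \<open>Over a finite field the number of words determines the dimension, so counting the
  multiples of \<open>g\<close> replaces exhibiting a basis.\<close>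

lemma code_dim_poly_code:
  fixes g :: "'a::{field,finite} poly"
  assumes "g \<noteq> 0" "degree g \<le> N" "N > 0"
  shows "code_dim N (poly_code N g) = N - degree g"
proof -
  let ?V = "module_vec TYPE('a) N\<lparr>carrier := poly_code N g\<rparr>"
  have "linear_code N (poly_code N g)"
    unfolding poly_code_def by (rule linear_code_dvd)
  then interpret V: vectorspace class_ring ?V
    unfolding linear_code_def using vectorspace.subspace_is_vs[OF vec_vs] by blast
  have "card (poly_code N g) > 0"
    by (simp add: card_poly_code[OF assms])
  then have "finite (poly_code N g)"
    by (rule card_ge_0_finite)
  then have "CARD('a) ^ (N - degree g) = CARD('a) ^ code_dim N (poly_code N g)"
    using V.card_carrier_eq_power_dim by (simp add: code_dim_def card_poly_code[OF assms])
  moreover have "card {0, 1 :: 'a} \<le> CARD('a)"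
    by (intro card_mono) auto
  then have "CARD('a) > 1"
    by simp
  ultimately show ?thesis
    by (simp add: power_inject_exp)
qed

subsection \<open>Minimal polynomials and least common multiples\<close>

text \<open>Division with remainder by a nonzero element of least degree. Applied to annihilators
  and to common multiples, it shows that the two \<open>THE\<close> definitions denote.\<close>

lemma poly_ideal_monic_generator:
  fixes P :: "'a::field poly \<Rightarrow> bool"
  assumes "P f" "f \<noteq> 0"
    and add: "\<And>p q. P p \<Longrightarrow> P q \<Longrightarrow> P (p + q)" and mult: "\<And>p q. P p \<Longrightarrow> P (q * p)"
  obtains l where "lead_coeff l = 1" "\<And>h. P h \<longleftrightarrow> l dvd h"
proof -
  obtain p where p: "P p" "p \<noteq> 0" and min: "\<And>h. P h \<Longrightarrow> h \<noteq> 0 \<Longrightarrow> degree p \<le> degree h"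
    using ex_has_least_nat[of "\<lambda>p. P p \<and> p \<noteq> 0" f degree] assms(1,2) by auto
  define l where "l = Polynomial.smult (inverse (lead_coeff p)) p"
  show thesis
  proof
    show "lead_coeff l = 1"
      using p by (simp add: l_def)
    fix h
    have "P h \<longleftrightarrow> p dvd h"
    proof
      assume "P h"
      have "h mod p = h + - (h div p) * p"
        by (simp add: minus_div_mult_eq_mod flip: diff_conv_add_uminus)
      then have "P (h mod p)"
        using add[OF \<open>P h\<close> mult[OF p(1), of "- (h div p)"]] by simp
      then have "h mod p = 0"
        using min[of "h mod p"] degree_mod_less[of p h] p by (cases "h mod p = 0") auto
      then show "p dvd h"
        by auto
    next
      assume "p dvd h"
      then show "P h"
        using mult[OF p(1)] by (metis dvdE mult.commute)
    qed
    then show "P h \<longleftrightarrow> l dvd h"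
      using p by (simp add: l_def smult_dvd_iff)
  qed
qed

lemma minimal_poly_dvd_iff:
  fixes \<iota> :: "'a::field \<Rightarrow> 'b::field"
  assumes \<iota>: "field_hom \<iota>" and f: "f \<noteq> 0" "poly (map_poly \<iota> f) x = 0"
  shows "minimal_poly \<iota> x dvd h \<longleftrightarrow> poly (map_poly \<iota> h) x = 0"
proof -
  interpret \<iota>: field_hom \<iota> by fact
  interpret m\<iota>: map_poly_inj_idom_hom \<iota> ..
  obtain l where l: "lead_coeff l = 1" "\<And>h. poly (map_poly \<iota> h) x = 0 \<longleftrightarrow> l dvd h"
    using poly_ideal_monic_generator[of "\<lambda>h. poly (map_poly \<iota> h) x = 0" f] f
    by (auto simp: m\<iota>.hom_add m\<iota>.hom_mult)
  have "minimal_poly \<iota> x = l"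
    unfolding minimal_poly_def
  proof (rule the_equality)
    show "lead_coeff l = 1 \<and> poly (map_poly \<iota> l) x = 0 \<and>
        (\<forall>h. h \<noteq> 0 \<and> poly (map_poly \<iota> h) x = 0 \<longrightarrow> degree l \<le> degree h)"
      using l by (auto intro: dvd_imp_degree_le)
    fix p
    assume p: "lead_coeff p = 1 \<and> poly (map_poly \<iota> p) x = 0 \<and>
        (\<forall>h. h \<noteq> 0 \<and> poly (map_poly \<iota> h) x = 0 \<longrightarrow> degree p \<le> degree h)"
    have nz: "l \<noteq> 0" "p \<noteq> 0"
      using l(1) p by auto
    obtain k where k: "p = l * k"
      using p l(2) by (auto elim!: dvdE)
    have "degree p \<le> degree l"
      using p nz l(2)[of l] by simp
    then have "degree k = 0"
      using k nz by (auto simp: degree_mult_eq)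
    then obtain c where "k = [:c:]"
      by (rule degree_eq_zeroE)
    then have pl: "p = Polynomial.smult c l"
      using k by simp
    then have "c = 1"
      using p l(1) by (simp only: lead_coeff_smult) simp
    with pl show "p = l"
      by simp
  qed
  with l(2) show ?thesis
    by simp
qed

lemma monic_Lcm_dvd_iff:
  fixes P :: "'a::field poly set"
  assumes "f \<noteq> 0" "\<And>p. p \<in> P \<Longrightarrow> p dvd f"
  shows "monic_Lcm P dvd h \<longleftrightarrow> (\<forall>p\<in>P. p dvd h)" and "lead_coeff (monic_Lcm P) = 1"
proof -
  obtain l where l: "lead_coeff l = 1" "\<And>h. (\<forall>p\<in>P. p dvd h) \<longleftrightarrow> l dvd h"
    using poly_ideal_monic_generator[of "\<lambda>h. \<forall>p\<in>P. p dvd h" f] assms by auto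
  have "monic_Lcm P = l"
    unfolding monic_Lcm_def
  proof (rule the_equality)
    show "lead_coeff l = 1 \<and> (\<forall>p\<in>P. p dvd l) \<and> (\<forall>h. (\<forall>p\<in>P. p dvd h) \<longrightarrow> l dvd h)"
      using l by simp
    fix l'
    assume "lead_coeff l' = 1 \<and> (\<forall>p\<in>P. p dvd l') \<and> (\<forall>h. (\<forall>p\<in>P. p dvd h) \<longrightarrow> l' dvd h)"
    then show "l' = l"
      using l by (intro poly_dvd_antisym) auto
  qed
  with l show "monic_Lcm P dvd h \<longleftrightarrow> (\<forall>p\<in>P. p dvd h)" "lead_coeff (monic_Lcm P) = 1"
    by simp_all
qed

subsection \<open>The BCH code and its Hermitian dual\<close>

lemma map_poly_reflect_poly:
  assumes "field_hom (\<iota> :: 'a::field \<Rightarrow> 'b::field)"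
  shows "map_poly \<iota> (reflect_poly p) = reflect_poly (map_poly \<iota> p)"
proof -
  interpret \<iota>: field_hom \<iota> by fact
  show ?thesis
    by (rule poly_eqI) (auto simp: coeff_reflect_poly)
qed

text \<open>Here \<open>b\<close> is q1. The equations for \<open>n\<close> and \<delta> are written
  additively to avoid truncated subtraction.\<close>

locale hermitian_bch =
  fixes \<iota> :: "'a::{field,finite} \<Rightarrow> 'b::{field,finite}"
    and \<beta> :: 'b and b m n \<delta> s :: nat
  assumes \<iota>: "field_hom \<iota>"
    and s: "s \<ge> 1" and b: "b = 2 ^ s"
    and m: "even m" "m > 0"
    and card_a: "CARD('a) = b ^ 2" and card_b: "CARD('b) = b ^ (2 * m)"
    and n: "n + 1 = b ^ (2 * m)"
    and \<beta>: "primitive_root_of_unity n \<beta>"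
    and \<delta>: "\<delta> + 2 * b ^ 2 = b ^ (m + 1) + 1" and \<delta>2: "\<delta> \<ge> 2"
begin

sublocale \<iota>: field_hom \<iota>
  by (rule \<iota>)

sublocale map_poly_\<iota>: map_poly_inj_idom_hom \<iota>
  ..

lemma b_ge_2: "b \<ge> 2"
  using s power_increasing[of 1 s "2 :: nat"] by (simp add: b)

lemma n_pos: "n > 0"
  using \<beta> by (simp add: primitive_root_of_unity_def)

lemma two_a: "(2 :: 'a) = 0" and two_b: "(2 :: 'b) = 0"
  using s m by (auto intro!: finite_field_two_eq_0 simp: card_a card_b b)

lemma power_card_b: "(x :: 'b) ^ (b ^ (2 * m)) = x"
  using finite_field_power_CARD[of x] by (simp add: card_b)

sublocale hermitian_conj b "TYPE('a)"
proof (rule hermitian_conj.intro)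
  show "field_hom (\<lambda>a::'a. a ^ b)"
    unfolding b using two_a by (rule field_hom_power_2_power)
  show "(a ^ b) ^ b = a" for a :: 'a
    using finite_field_power_CARD[of a] by (simp add: card_a power2_eq_square power_mult)
qed

abbreviation ev :: "'a poly \<Rightarrow> nat \<Rightarrow> 'b" where
  "ev p e \<equiv> poly (map_poly \<iota> p) (\<beta> ^ e)"

lemma ev_monom_diff_1: "ev (monom 1 n - 1) e = 0"
  using \<beta>
  by (simp add: map_poly_\<iota>.hom_minus poly_monom primitive_root_of_unity_def flip: power_mult)
    (simp add: mult.commute[of e] power_mult)

definition bch_gen :: "'a poly" where
  "bch_gen = monic_Lcm ((\<lambda>i. minimal_poly \<iota> (\<beta> powi i)) ` {1..1 + int \<delta> - 2})"

lemma bch_gen_dvd_iff: "bch_gen dvd h \<longleftrightarrow> (\<forall>i. 1 \<le> i \<and> i < \<delta> \<longrightarrow> ev h i = 0)"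
  and monic_bch_gen: "lead_coeff bch_gen = 1"
proof -
  let ?I = "{1..1 + int \<delta> - 2}"
  let ?M = "monom 1 n - 1 :: 'a poly"
  have nz: "?M \<noteq> 0"
    using n_pos by (rule degree_monom_diff_1)
  have powi: "\<beta> powi i = \<beta> ^ nat i" if "i \<in> ?I" for i
    using that by (simp add: power_int_def)
  have min: "minimal_poly \<iota> (\<beta> powi i) dvd h \<longleftrightarrow> ev h (nat i) = 0" if "i \<in> ?I" for i h
    using minimal_poly_dvd_iff[OF \<iota> nz ev_monom_diff_1] by (simp add: powi[OF that])
  have dvd: "p dvd ?M" if "p \<in> (\<lambda>i. minimal_poly \<iota> (\<beta> powi i)) ` ?I" for p
    using that min ev_monom_diff_1 by auto
  have "bch_gen dvd h \<longleftrightarrow> (\<forall>i\<in>?I. ev h (nat i) = 0)"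
    using monic_Lcm_dvd_iff(1)[OF nz dvd] min by (auto simp: bch_gen_def)
  also have "\<dots> \<longleftrightarrow> (\<forall>i. 1 \<le> i \<and> i < \<delta> \<longrightarrow> ev h i = 0)"
  proof (intro iffI allI impI ballI)
    fix i :: nat
    assume "\<forall>i\<in>?I. ev h (nat i) = 0" and "1 \<le> i \<and> i < \<delta>"
    then show "ev h i = 0"
      by (auto dest!: bspec[of _ _ "int i"])
  next
    fix i
    assume "\<forall>i. 1 \<le> i \<and> i < \<delta> \<longrightarrow> ev h i = 0" and "i \<in> ?I"
    then show "ev h (nat i) = 0"
      by (auto simp: nat_less_iff)
  qed
  finally show "bch_gen dvd h \<longleftrightarrow> (\<forall>i. 1 \<le> i \<and> i < \<delta> \<longrightarrow> ev h i = 0)" .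
  show "lead_coeff bch_gen = 1"
    using monic_Lcm_dvd_iff(2)[OF nz dvd] by (simp add: bch_gen_def)
qed

lemma bch_gen_dvd: "bch_gen dvd monom 1 n - 1"
  by (simp add: bch_gen_dvd_iff ev_monom_diff_1)

definition bch_check :: "'a poly" where
  "bch_check = (monom 1 n - 1) div bch_gen"

lemma bch_gen_check: "bch_gen * bch_check = monom 1 n - 1"
  using bch_gen_dvd by (simp add: bch_check_def)

text \<open>The product of the orbit polynomials of the designed zeros has base field coefficients
  and vanishes at those zeros. So \<open>bch_gen\<close> divides it and has no roots outside these
  orbits.\<close>

lemma bch_gen_root:
  assumes "poly (map_poly \<iota> bch_gen) y = 0"
  obtains i k where "1 \<le> i" "i < \<delta>" "k < m" "y = (\<beta> ^ i) ^ (b ^ 2) ^ k"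
proof -
  have "\<exists>p. map_poly \<iota> p = (\<Prod>k<m. [:- (x ^ (CARD('a) ^ k)), 1:])" for x
  proof -
    have "CARD('a) = 2 ^ (s * 2)" "CARD('b) = CARD('a) ^ m"
      by (simp_all add: card_a card_b b flip: power_mult)
    then show ?thesis
      using conjugates_poly[OF \<iota> two_b] by metis
  qed
  then obtain p where p: "\<And>x. map_poly \<iota> (p x) = (\<Prod>k<m. [:- (x ^ ((b ^ 2) ^ k)), 1:])"
    unfolding card_a by metis
  define f where "f = (\<Prod>i\<in>{1..<\<delta>}. p (\<beta> ^ i))"
  have f: "poly (map_poly \<iota> f) z = (\<Prod>i\<in>{1..<\<delta>}. \<Prod>k<m. z - (\<beta> ^ i) ^ (b ^ 2) ^ k)" for z
    by (simp add: f_def map_poly_\<iota>.hom_prod poly_prod p)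
  have "bch_gen dvd f"
    unfolding bch_gen_dvd_iff
  proof (intro allI impI)
    fix i
    assume i: "1 \<le> i \<and> i < \<delta>"
    have "(\<Prod>k<m. \<beta> ^ i - (\<beta> ^ i) ^ (b ^ 2) ^ k) = 0"
      using m by (intro prod_zero[of _ ]) (auto intro!: bexI[of _ 0])
    then show "ev f i = 0"
      using i unfolding f by (intro prod_zero) auto
  qed
  then have "map_poly \<iota> bch_gen dvd map_poly \<iota> f"
    by (rule map_poly_\<iota>.hom_dvd)
  then have "poly (map_poly \<iota> f) y = 0"
    using assms by (auto elim!: dvdE)
  then show thesis
    unfolding f using that by auto
qed

definition dual_gen :: "'a poly" where
  "dual_gen = Polynomial.smult (inverse (lead_coeff (recip bch_check))) (recip bch_check)"

text \<open>With \<open>z ^ b = inverse (\<beta> ^ j)\<close>, the claim reduces to \<open>z\<close>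
  being a root of \<open>bch_check\<close>. As \<open>z\<close> is an n-th root of unity, it
  suffices that it is no root of \<open>bch_gen\<close>; such a root would give
  \<open>\<beta> ^ (j + i * b ^ (2 * k + 1)) = 1\<close>.\<close>

lemma ev_dual_gen_eq_0:
  assumes j: "j \<le> J \<or> (b ^ (m + 1) \<le> j \<and> j \<le> b ^ (m + 1) + J)"
    and J1: "J + 1 < b ^ (m + 1)"
    and J2: "J * b ^ (m - 1) + b ^ (m + 1) + 2 < b ^ (2 * m) + 2 * b ^ 2"
  shows "ev dual_gen j = 0"
proof -
  have \<beta>nz: "\<beta> \<noteq> 0"
    using \<beta> n_pos by (auto simp: primitive_root_of_unity_def power_0_left)
  \<comment> \<open>The power \<open>b ^ (2 * m - 1)\<close> inverts the b-th power map on the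
    extension field.\<close>
  define z where "z = inverse (\<beta> ^ j) ^ (b ^ (2 * m - 1))"
  have zb: "z ^ b = inverse (\<beta> ^ j)"
  proof -
    have "b ^ (2 * m - 1) * b = b ^ (2 * m)"
      using m by (simp flip: power_Suc2)
    then show ?thesis
      using power_card_b[of "inverse (\<beta> ^ j)"] by (simp add: z_def flip: power_mult)
  qed
  have "poly (map_poly \<iota> bch_gen) z \<noteq> 0"
  proof
    assume "poly (map_poly \<iota> bch_gen) z = 0"
    then obtain i k where ik: "1 \<le> i" "i < \<delta>" "k < m" and z: "z = (\<beta> ^ i) ^ (b ^ 2) ^ k"
      by (rule bch_gen_root)
    have "inverse (\<beta> ^ j) = \<beta> ^ (i * b ^ (2 * k + 1))"
      by (simp add: z mult_ac flip: zb power_mult)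
    then have "\<beta> ^ (j + i * b ^ (2 * k + 1)) = 1"
      using \<beta>nz by (simp only: power_add) (metis power_not_zero right_inverse)
    moreover have "\<beta> ^ (j + i * b ^ (2 * k + 1)) \<noteq> 1"
      using ik \<delta> by (intro power_in_run_ne_conjugate[OF \<beta> n m b_ge_2 _ _ _ _ j J1 J2]) auto
    ultimately show False
      by contradiction
  qed
  moreover have "poly (map_poly \<iota> (bch_gen * bch_check)) z = 0"
    using ev_monom_diff_1 \<beta>
    by (simp add: bch_gen_check map_poly_\<iota>.hom_minus poly_monom z_def primitive_root_of_unity_def
        power_inverse flip: power_mult)
  ultimately have "poly (map_poly \<iota> bch_check) z = 0"
    by (simp add: map_poly_\<iota>.hom_mult)
  then have "poly (map_poly \<iota> (map_poly (\<lambda>a. a ^ b) bch_check)) (inverse (\<beta> ^ j)) = 0"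
    using poly_map_poly_power_2_power[OF two_b \<iota>, of s bch_check z] b_ge_2 by (simp add: zb flip: b)
  then show ?thesis
    using \<beta>nz by (simp add: dual_gen_def recip_def \<iota>.map_poly_hom_smult map_poly_reflect_poly[OF \<iota>]
        poly_reflect_poly_nz)
qed

section \<open>Run lengths, and the inclusion of the dual in the BCH code\<close>

lemma P_Q: "b ^ (m + 1) * b ^ (m - 1) = b ^ (2 * m)"
  using m by (subst power_add[symmetric]) (simp add: mult_2)

lemma sq_Q: "b ^ 2 * b ^ (m - 1) = b ^ (m + 1)"
  using m by (subst power_add[symmetric]) simp

lemma sq_less_P: "2 * b ^ 2 < b ^ (m + 1)"
  using \<delta> \<delta>2 by linarith

lemma standard_run:
  defines "J \<equiv> b ^ (m + 1) - b ^ 2"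
  shows "J + 1 < b ^ (m + 1)" "J * b ^ (m - 1) + b ^ (m + 1) + 2 < b ^ (2 * m) + 2 * b ^ 2"
    "\<delta> \<le> J + 1"
proof -
  have b2: "b ^ 2 \<ge> 4"
    using power_mono[OF b_ge_2, of 2] by simp
  have J: "J + b ^ 2 = b ^ (m + 1)"
    using sq_less_P by (simp add: J_def)
  then have "J * b ^ (m - 1) + b ^ (m + 1) = b ^ (2 * m)"
    by (metis P_Q add_mult_distrib sq_Q)
  with b2 show "J * b ^ (m - 1) + b ^ (m + 1) + 2 < b ^ (2 * m) + 2 * b ^ 2"
    by linarith
  show "J + 1 < b ^ (m + 1)" "\<delta> \<le> J + 1"
    using J b2 \<delta> by linarith+
qed

lemma ev_dual_gen_small: "i < \<delta> \<Longrightarrow> ev dual_gen i = 0"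
  using ev_dual_gen_eq_0[OF _ standard_run(1,2), of i] standard_run(3) by simp

text \<open>All designed zeros of the code lie in the first run of the dual. This is the
  divisibility that the doubling construction requires.\<close>

lemma bch_gen_dvd_dual_gen: "bch_gen dvd dual_gen"
  by (simp add: bch_gen_dvd_iff ev_dual_gen_small)

lemmas dual_gen_generator = generator_hermitian_dual[OF bch_gen_check n_pos, folded dual_gen_def]

definition dual_check :: "'a poly" where
  "dual_check = (monom 1 n - 1) div dual_gen"

lemma dual_gen_check: "dual_gen * dual_check = monom 1 n - 1"
  using dual_gen_generator(1) by (simp add: is_generator_poly_def dual_check_def)

text \<open>The roots of x^n - 1 are simple: \<open>n + 1\<close> is a power of 2, so
  \<open>n\<close> is nonzero in the field and the derivative does not vanish at powers of
  \<beta>.\<close>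

lemma ev_dual_check_nz:
  assumes "ev dual_gen i = 0"
  shows "ev dual_check i \<noteq> 0"
proof
  assume "ev dual_check i = 0"
  have "pderiv (map_poly \<iota> (dual_gen * dual_check)) = map_poly \<iota> dual_gen * pderiv (map_poly \<iota> dual_check) +
      map_poly \<iota> dual_check * pderiv (map_poly \<iota> dual_gen)"
    by (simp add: map_poly_\<iota>.hom_mult pderiv_mult)
  then have "poly (pderiv (map_poly \<iota> (dual_gen * dual_check))) (\<beta> ^ i) = 0"
    using assms \<open>ev dual_check i = 0\<close> by simp
  then have "of_nat n * (\<beta> ^ i) ^ (n - 1) = 0"
    by (simp add: dual_gen_check map_poly_\<iota>.hom_minus pderiv_diff pderiv_monom poly_monom)
  moreover have "(of_nat n :: 'b) \<noteq> 0"
  proof -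
    have "of_nat (n + 1) = (0 :: 'b)"
      unfolding n b using two_b s m by (simp add: power_0_left)
    then show ?thesis
      by auto
  qed
  moreover have "\<beta> \<noteq> 0"
    using \<beta> n_pos by (auto simp: primitive_root_of_unity_def power_0_left)
  ultimately show False
    by simp
qed

lemma degree_dual_gen: "degree dual_gen + degree bch_gen = n" and degree_dual_gen_less: "degree dual_gen < n"
proof -
  have "degree dual_gen = degree bch_check"
    using generator_hermitian_dual(2)[OF bch_gen_check n_pos] cofactor_coeff_0[OF bch_gen_check n_pos]
    by (simp add: dual_gen_def degree_recip)
  then show "degree dual_gen + degree bch_gen = n"
    using cofactor_degree[OF bch_gen_check n_pos] by simp
  have "degree bch_gen \<noteq> 0"
  proof
    assume "degree bch_gen = 0"
    then have "bch_gen = 1"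
      using monic_bch_gen by (metis degree_eq_zeroE lead_coeff_pCons(2) one_pCons)
    then have "ev 1 1 = 0"
      using bch_gen_dvd_iff[of 1] \<delta>2 by auto
    then show False
      by simp
  qed
  with \<open>degree dual_gen + degree bch_gen = n\<close> show "degree dual_gen < n"
    by simp
qed

section \<open>Weights of words in the BCH code and in its dual\<close>

lemma ev_support: "ev p e = (\<Sum>t\<in>{t. coeff p t \<noteq> 0}. \<iota> (coeff p t) * (\<beta> ^ t) ^ e)"
proof -
  have "ev p e = (\<Sum>t\<le>degree p. \<iota> (coeff p t) * (\<beta> ^ t) ^ e)"
    by (simp add: poly_altdef mult.commute flip: power_mult)
  also have "\<dots> = (\<Sum>t\<in>{t. coeff p t \<noteq> 0}. \<iota> (coeff p t) * (\<beta> ^ t) ^ e)"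
    by (rule sum.mono_neutral_right) (auto intro: le_degree)
  finally show ?thesis .
qed

lemma inj_on_powers:
  assumes "degree p < n"
  shows "inj_on (\<lambda>t. \<beta> ^ t) {t. coeff p t \<noteq> 0}"
proof -
  have "\<beta> \<noteq> 0"
    using \<beta> n_pos by (auto simp: primitive_root_of_unity_def power_0_left)
  have "inj_on (\<lambda>t. \<beta> ^ t) {..<n}"
  proof (rule linorder_inj_onI)
    fix t u
    assume tu: "t < u" "t \<in> {..<n}" "u \<in> {..<n}"
    then have "\<beta> ^ u = \<beta> ^ t * \<beta> ^ (u - t)"
      by (simp flip: power_add)
    moreover have "\<beta> ^ (u - t) \<noteq> 1"
      using tu by (intro primitive_root_power_ne_1[OF \<beta>]) auto
    ultimately show "\<beta> ^ t \<noteq> \<beta> ^ u"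
      using \<open>\<beta> \<noteq> 0\<close> by simp
  qed auto
  then show ?thesis
    by (rule inj_on_subset) (use assms le_degree le_less_trans in blast)
qed

text \<open>The designed run starts at exponent 1; absorbing one factor \<open>\<beta> ^ t\<close>
  into the coefficients lets it start at 0.\<close>

lemma poly_weight_bch:
  assumes "p \<noteq> 0" "degree p < n" "bch_gen dvd p"
  shows "\<delta> \<le> poly_weight p"
proof -
  have "(\<delta> - 2) + 2 \<le> card {t. coeff p t \<noteq> 0}"
  proof (rule weight_gt_run[OF finite_poly_support _ inj_on_powers[OF assms(2)]])
    show "{t. coeff p t \<noteq> 0} \<noteq> {}"
      using assms(1) by (auto simp: poly_eq_iff)
    show "\<iota> (coeff p t) * \<beta> ^ t \<noteq> 0" if "t \<in> {t. coeff p t \<noteq> 0}" for t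
      using that \<beta> n_pos by (auto simp: primitive_root_of_unity_def power_0_left)
    show "(\<Sum>t\<in>{t. coeff p t \<noteq> 0}. \<iota> (coeff p t) * \<beta> ^ t * (\<beta> ^ t) ^ j) = 0" if "j \<le> \<delta> - 2" for j
      using assms(3) that \<delta>2 unfolding bch_gen_dvd_iff
      by (auto simp: mult.assoc ev_support dest!: spec[of _ "Suc j"])
  qed
  then show ?thesis
    using \<delta>2 by (simp add: poly_weight_def)
qed

lemma poly_weight_dual:
  assumes p: "p \<noteq> 0" "degree p < n" "dual_gen dvd p"
    and J1: "J + 1 < b ^ (m + 1)"
    and J2: "J * b ^ (m - 1) + b ^ (m + 1) + 2 < b ^ (2 * m) + 2 * b ^ 2"
  shows "J + 2 \<le> poly_weight p"
    and "poly_weight p \<le> 2 * J + 2 \<Longrightarrow> poly_weight p \<le> b ^ (m - 1) * (poly_weight p - J - 2) + 1"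
proof -
  let ?T = "{t. coeff p t \<noteq> 0}"
  have "ev p j = 0" if "j \<le> J \<or> (b ^ (m + 1) \<le> j \<and> j \<le> b ^ (m + 1) + J)" for j
  proof -
    have "map_poly \<iota> dual_gen dvd map_poly \<iota> p"
      using p(3) by (rule map_poly_\<iota>.hom_dvd)
    then show ?thesis
      using ev_dual_gen_eq_0[OF that J1 J2] by (auto elim!: dvdE)
  qed
  then have run: "(\<Sum>t\<in>?T. \<iota> (coeff p t) * (\<beta> ^ t) ^ j) = 0"
      "(\<Sum>t\<in>?T. \<iota> (coeff p t) * (\<beta> ^ t) ^ (b ^ (m + 1) + j)) = 0" if "j \<le> J" for j
    using that by (simp_all flip: ev_support)
  have ne: "?T \<noteq> {}"
    using p(1) by (auto simp: poly_eq_iff)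
  note T = finite_poly_support ne inj_on_powers[OF p(2)]
  show "J + 2 \<le> poly_weight p"
    unfolding poly_weight_def using weight_gt_run[OF T _ run(1)] by simp
  assume le: "poly_weight p \<le> 2 * J + 2"
  have "b ^ 1 \<le> b ^ (m - 1)"
    using b_ge_2 m by (intro power_increasing) (auto elim!: evenE)
  then have Q: "2 \<le> b ^ (m - 1)"
    using b_ge_2 by simp
  show "poly_weight p \<le> b ^ (m - 1) * (poly_weight p - J - 2) + 1"
    unfolding poly_weight_def
  proof (rule weight_two_runs[OF T _ run _ Q])
    show "(\<beta> ^ t) ^ (b ^ (m + 1) * b ^ (m - 1)) = \<beta> ^ t" for t
      unfolding P_Q by (rule power_card_b)
  qed (use le in \<open>auto simp: poly_weight_def\<close>)
qed

text \<open>Write \<open>w\<close> for the weight, P = \<open>b ^ (m + 1)\<close>, Q =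
  \<open>b ^ (m - 1)\<close> and \<open>e = b ^ 2 - K\<close>. If the claim fails, then
  \<open>w = P + 2 - e\<close>, while the root count gives \<open>w \<le> P + 1 - Q * e\<close>, a
  contradiction.\<close>

lemma poly_weight_dual_ge:
  assumes p: "p \<noteq> 0" "degree p < n" "dual_gen dvd p"
  shows "b ^ (m + 1) + 3 \<le> poly_weight p"
proof (rule ccontr)
  assume less: "\<not> ?thesis"
  define J K where "J = b ^ (m + 1) - b ^ 2" and "K = poly_weight p - J - 2"
  note bounds = poly_weight_dual[OF p standard_run(1,2), folded J_def K_def]
  have J: "J + b ^ 2 = b ^ (m + 1)"
    using sq_less_P by (simp add: J_def)
  then have w: "poly_weight p + b ^ 2 = K + b ^ (m + 1) + 2"
    using bounds(1) by (simp add: K_def)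
  with less have "K \<le> b ^ 2"
    by linarith
  then obtain e where e: "b ^ 2 = K + e"
    by (rule le_Suc_ex[THEN exE])
  have "poly_weight p \<le> 2 * J + 2"
    using less J sq_less_P by linarith
  then have "poly_weight p \<le> b ^ (m - 1) * K + 1"
    by (rule bounds(2))
  moreover have "b ^ (m - 1) * K + b ^ (m - 1) * e = b ^ (m + 1)"
    using sq_Q unfolding e by (simp only: add_mult_distrib mult.commute)
  moreover have "1 * e \<le> b ^ (m - 1) * e"
    using b_ge_2 by (intro mult_le_mono) auto
  ultimately show False
    using w e by linarith
qed

lemma poly_weight_dual_ge_m2:
  assumes p: "p \<noteq> 0" "degree p < n" "dual_gen dvd p" and m2: "m = 2"
  shows "b ^ 3 + 2 * b + 4 \<le> poly_weight p"
proof (rule ccontr)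
  assume less: "\<not> ?thesis"
  \<comment> \<open>The largest run length allowed by the second bound in
    \<open>poly_weight_dual\<close> for \<open>m = 2\<close>.\<close>
  define J where "J = b ^ 3 + 2 * b - b ^ 2 - 1"
  define K where "K = poly_weight p - J - 2"
  have b3: "b ^ 3 = b * b ^ 2"
    by (simp add: power2_eq_square power3_eq_cube)
  \<comment> \<open>For \<open>m = 2\<close> the assumption \<open>\<delta> \<ge> 2\<close> excludes
    \<open>b = 2\<close>.\<close>
  have "2 * b ^ 2 < b * b ^ 2"
    using sq_less_P by (simp only: m2 flip: b3) simp
  then have "b \<ge> 3"
    by simp
  then have "b * b \<ge> 3 * b"
    by simp
  then have sq: "b ^ 2 \<ge> 2 * b + 3"
    using \<open>b \<ge> 3\<close> unfolding power2_eq_square by linarith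
  have "3 * b ^ 2 \<le> b * b ^ 2"
    using \<open>b \<ge> 3\<close> by (intro mult_le_mono1)
  then have J: "J + b ^ 2 + 1 = b ^ 3 + 2 * b"
    unfolding J_def b3 using \<open>b \<ge> 3\<close> by linarith
  have J1: "J + 1 < b ^ (m + 1)"
    using J sq by (simp add: m2)
  have "J * b + b ^ 2 * b + 1 * b = b ^ 3 * b + 2 * b * b"
    using arg_cong[OF J, of "\<lambda>x. x * b"] by (simp only: add_mult_distrib)
  then have "J * b + b ^ 3 + b = b ^ 4 + 2 * b ^ 2"
    by (simp add: power2_eq_square power3_eq_cube power4_eq_xxxx mult.assoc)
  then have J2: "J * b ^ (m - 1) + b ^ (m + 1) + 2 < b ^ (2 * m) + 2 * b ^ 2"
    using \<open>b \<ge> 3\<close> by (simp add: m2)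
  note bounds = poly_weight_dual[OF p J1 J2, folded K_def]
  have w: "poly_weight p + b ^ 2 = K + b ^ 3 + 2 * b + 1"
    using bounds(1) J by (simp add: K_def)
  with less have "K \<le> b ^ 2 + 2"
    by linarith
  then obtain e where e: "b ^ 2 + 2 = K + e"
    by (rule le_Suc_ex[THEN exE])
  have "poly_weight p \<le> 2 * J + 2"
    using less J \<open>3 * b ^ 2 \<le> b * b ^ 2\<close> sq unfolding b3 by linarith
  then have "poly_weight p \<le> b * K + 1"
    using bounds(2) by (simp add: m2)
  moreover have "b * K + b * e = b ^ 3 + 2 * b"
    by (simp add: b3 flip: add_mult_distrib2 e)
  moreover have "1 * e \<le> b * e"
    using \<open>b \<ge> 3\<close> by (intro mult_le_mono) auto
  ultimately show False
    using w e by linarith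
qed

section \<open>The code of length 2n: self-duality and parameters\<close>

lemma dual_code_eq: "hermitian_dual b n (code_generated_by n bch_gen) = poly_code n dual_gen"
  and bch_gen_code_eq: "code_generated_by n bch_gen = poly_code n bch_gen"
  and double_code_eq: "code_generated_by (2 * n) (bch_gen * dual_gen) = poly_code (2 * n) (bch_gen * dual_gen)"
  and double_dvd: "bch_gen * dual_gen dvd monom 1 (2 * n) - 1"
  and double_self_dual: "hermitian_self_dual b (2 * n) (code_generated_by (2 * n) (bch_gen * dual_gen))"
proof -
  note self_dual = hermitian_self_dual_double[OF bch_gen_check n_pos two_a _ dual_gen_def]
  have u: "inverse (lead_coeff (recip bch_check)) \<noteq> 0"
    by (rule generator_hermitian_dual(2)[OF bch_gen_check n_pos])
  show dvd: "bch_gen * dual_gen dvd monom 1 (2 * n) - 1"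
    and "hermitian_self_dual b (2 * n) (code_generated_by (2 * n) (bch_gen * dual_gen))"
    using self_dual[OF u] by simp_all
  show "hermitian_dual b n (code_generated_by n bch_gen) = poly_code n dual_gen"
    "code_generated_by n bch_gen = poly_code n bch_gen"
    "code_generated_by (2 * n) (bch_gen * dual_gen) = poly_code (2 * n) (bch_gen * dual_gen)"
    using dual_gen_generator(1) n_pos bch_gen_dvd dvd
    by (simp_all add: is_generator_poly_def code_generated_by_dvd poly_code_def)
qed

lemma min_distance_double_code:
  "min_distance (poly_code (2 * n) (bch_gen * dual_gen)) =
    min (2 * min_distance (poly_code n bch_gen)) (min_distance (poly_code n dual_gen))"
proof (rule min_distance_double[OF two_a n_pos dual_gen_check bch_gen_dvd_dual_gen _ degree_dual_gen_less])
  fix p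
  assume "bch_gen dvd dual_check * p"
  \<comment> \<open>The designed zeros are zeros of \<open>dual_gen\<close>, hence not of
    \<open>dual_check\<close>, so they must be zeros of \<open>p\<close>.\<close>
  then show "bch_gen dvd p"
    unfolding bch_gen_dvd_iff using ev_dual_check_nz[OF ev_dual_gen_small] by (simp add: map_poly_\<iota>.hom_mult)
qed

lemma generators_nz: "bch_gen \<noteq> 0" "dual_gen \<noteq> 0"
  using monic_bch_gen dual_gen_check degree_monom_diff_1(2)[OF n_pos, where 'a='a] by auto

lemma code_params_double:
  "code_params (2 * n) n (min_distance (poly_code (2 * n) (bch_gen * dual_gen))) (poly_code (2 * n) (bch_gen * dual_gen))"
proof -
  have "degree (bch_gen * dual_gen) = n"
    using generators_nz degree_dual_gen by (simp add: degree_mult_eq)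
  then have "code_dim (2 * n) (poly_code (2 * n) (bch_gen * dual_gen)) = n"
    using generators_nz n_pos by (subst code_dim_poly_code) auto
  then show ?thesis
    unfolding code_params_def poly_code_def using linear_code_dvd by blast
qed

lemma min_distance_bch: "\<delta> \<le> min_distance (poly_code n bch_gen)"
proof -
  obtain p where "p \<noteq> 0" "degree p < n" "bch_gen dvd p" "poly_weight p = min_distance (poly_code n bch_gen)"
    using min_distance_poly_code_attained[OF generators_nz(2) degree_dual_gen_less bch_gen_dvd_dual_gen] by blast
  then show ?thesis
    using poly_weight_bch by metis
qed

lemma min_distance_dual:
  shows "b ^ (m + 1) + 3 \<le> min_distance (poly_code n dual_gen)"
    and "m = 2 \<Longrightarrow> b ^ 3 + 2 * b + 4 \<le> min_distance (poly_code n dual_gen)"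
proof -
  obtain p where "p \<noteq> 0" "degree p < n" "dual_gen dvd p" "poly_weight p = min_distance (poly_code n dual_gen)"
    using min_distance_poly_code_attained[OF generators_nz(2) degree_dual_gen_less dvd_refl] by blast
  then show "b ^ (m + 1) + 3 \<le> min_distance (poly_code n dual_gen)"
    and "m = 2 \<Longrightarrow> b ^ 3 + 2 * b + 4 \<le> min_distance (poly_code n dual_gen)"
    using poly_weight_dual_ge[of p] poly_weight_dual_ge_m2[of p] by simp_all
qed

end

theorem theorem7:
  fixes \<iota> :: "'a::{field,finite} \<Rightarrow> 'b::{field,finite}"
    and \<beta> :: 'b
    and q1 q m n \<delta> s :: nat
    and C C' :: "'a vec set"
    and g g_perp :: "'a poly"
  assumes "field_hom \<iota>"
    and "s \<ge> 1" and "q1 = 2 ^ s" and "q = q1 ^ 2"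
    and "even m" and "m > 0"
    and "CARD('a) = q" and "CARD('b) = q ^ m"
    and "n = q ^ m - 1"
    and "primitive_root_of_unity n \<beta>"
    and "int \<delta> = int q1 ^ (m + 1) - 2 * int q1 ^ 2 + 1" and "\<delta> \<ge> 2"
    and "C = bch_code \<iota> n \<delta> 1 \<beta>"
    and "g = generator_poly n C"
    and "g_perp = generator_poly n (hermitian_dual q1 n C)"
    and "C' = code_generated_by (2 * n) (g * g_perp)"
  shows "cyclic_code (2 * n) C' \<and>
    is_generator_poly (2 * n) C' (g * g_perp) \<and>
    hermitian_self_dual q1 (2 * n) C' \<and>
    (\<exists>d. code_params (2 * n) n d C' \<and>
      (m \<ge> 4 \<longrightarrow>
         d = min (2 * min_distance C) (min_distance (hermitian_dual q1 n C)) \<and>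
         d \<ge> q1 ^ (m + 1) + 3) \<and>
      (q1 \<ge> 8 \<and> m = 2 \<longrightarrow>
         d = min (2 * min_distance C) (min_distance (hermitian_dual q1 n C)) \<and>
         d \<ge> q1 ^ 3 + 2 * q1 + 4) \<and>
      (q1 = 4 \<and> m = 2 \<longrightarrow>
         d = min (2 * min_distance C) (min_distance (hermitian_dual q1 n C)) \<and>
         d \<ge> 66))"
proof -
  have qm: "q ^ m = q1 ^ (2 * m)"
    by (simp add: assms(4) power_mult)
  have "q1 > 0"
    by (simp add: assms(3))
  have "int (\<delta> + 2 * q1 ^ 2) = int (q1 ^ (m + 1) + 1)"
    using assms(11) by simp
  then have \<delta>: "\<delta> + 2 * q1 ^ 2 = q1 ^ (m + 1) + 1"
    by (simp only: of_nat_eq_iff)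
  interpret hermitian_bch \<iota> \<beta> q1 m n \<delta> s
  proof (rule hermitian_bch.intro)
    show "CARD('a) = q1 ^ 2" "CARD('b) = q1 ^ (2 * m)"
      using assms(4,7,8) qm by simp_all
    show "n + 1 = q1 ^ (2 * m)"
      using assms(9) qm \<open>q1 > 0\<close> by simp
  qed (fact assms \<delta>)+
  have C: "C = code_generated_by n bch_gen"
    unfolding assms(13) bch_code_def bch_gen_def ..
  have "is_generator_poly n C bch_gen"
    using monic_bch_gen bch_gen_dvd by (simp add: is_generator_poly_def C)
  then have g: "g = bch_gen"
    using n_pos assms(14) by (simp add: generator_poly_eqI)
  have dual_gen: "g_perp = dual_gen"
    using n_pos assms(15) dual_gen_generator(1) by (simp add: generator_poly_eqI C)
  have C': "C' = poly_code (2 * n) (bch_gen * dual_gen)"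
    unfolding assms(16) g dual_gen by (rule double_code_eq)
  let ?d = "min_distance C'"
  have d: "?d = min (2 * min_distance C) (min_distance (hermitian_dual q1 n C))"
    unfolding C' min_distance_double_code C dual_code_eq unfolding bch_gen_code_eq ..
  have d1: "2 * \<delta> \<le> 2 * min_distance C"
    using min_distance_bch by (simp add: C bch_gen_code_eq)
  have d2: "q1 ^ (m + 1) + 3 \<le> min_distance (hermitian_dual q1 n C)"
    "m = 2 \<Longrightarrow> q1 ^ 3 + 2 * q1 + 4 \<le> min_distance (hermitian_dual q1 n C)"
    using min_distance_dual by (simp_all add: C dual_code_eq)
  \<comment> \<open>The dual meets the bound directly. For \<open>2 * \<delta>\<close> it suffices
    that \<open>q1 ^ (m + 1) \<ge> 4 * q1 ^ 2 + 1\<close>, which holds since the exponent is at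
    least 5.\<close>
  have "q1 ^ (m + 1) + 3 \<le> ?d" if "m \<ge> 4"
  proof -
    have "2 ^ 3 * q1 ^ 2 \<le> q1 ^ 3 * q1 ^ 2"
      using b_ge_2 by (intro mult_le_mono1 power_mono) auto
    also have "\<dots> \<le> q1 ^ (m + 1)"
      unfolding power_add[symmetric] using that \<open>q1 > 0\<close> by (intro power_increasing) auto
    finally have "8 * q1 ^ 2 \<le> q1 ^ (m + 1)"
      by simp
    moreover have "q1 ^ 2 \<ge> 1"
      using \<open>q1 > 0\<close> by simp
    ultimately show ?thesis
      unfolding d using d1 d2(1) \<delta> by linarith
  qed
  moreover have "q1 ^ 3 + 2 * q1 + 4 \<le> ?d" if "q1 \<ge> 8 \<and> m = 2"
  proof -
    have "8 * q1 ^ 2 \<le> q1 ^ 3"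
      using that by (simp add: power2_eq_square power3_eq_cube)
    moreover have "q1 ^ 2 \<ge> 8 * q1"
      using that by (simp add: power2_eq_square)
    moreover have "\<delta> + 2 * q1 ^ 2 = q1 ^ 3 + 1"
      using \<delta> that by simp
    ultimately show ?thesis
      unfolding d using d1 d2(2) that by linarith
  qed
  \<comment> \<open>Here \<open>\<delta> = 33\<close>, so 66 is \<open>2 * \<delta>\<close>; the
    dual already has distance at least 67.\<close>
  moreover have "66 \<le> ?d" if "q1 = 4 \<and> m = 2"
    unfolding d using d1 d2(1) \<delta> that by simp
  moreover have "code_params (2 * n) n ?d C'"
    unfolding C' by (rule code_params_double)
  moreover have "cyclic_code (2 * n) C'"
    unfolding C' poly_code_def using n_pos double_dvd by (intro cyclic_code_dvd) auto
  moreover have "is_generator_poly (2 * n) C' (g * g_perp)"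
    using double_dvd monic_bch_gen dual_gen_generator(1) unfolding is_generator_poly_def g dual_gen assms(16)
    by (simp add: lead_coeff_mult)
  moreover have "hermitian_self_dual q1 (2 * n) C'"
    unfolding assms(16) g dual_gen by (rule double_self_dual)
  ultimately show ?thesis
    using d by blast
qed

end
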